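(* Let $\mathbf{k}$ be a commutative ring, $E_\bullet$ a standard quotient flag over $\mathbf{k}$, and $k\ge1$. If the diagram $D$ is $k$-full, then the natural surjection $\mathsf{R}_{k+1}E_\bullet^D\to\mathsf{R}_kE_\bullet^D$ is an isomorphism.
   Context: Diagrams. A diagram is a finite tuple $D=[a^{(1)},\dots,a^{(m)}]$ of finite subsets of $\mathbb{Z}_{>0}$ (its columns). $D$ is $k$-full if for every column $a^{(j)}$, $k\in a^{(j)}$ implies $k+1\in a^{(j)}$. Standard flag. Let $n$ be large enough that $n\geq k$ and all boxes of $D$ are in rows $1,\dots,n$ (all $a^{(j)}\subseteq\{1,\dots,n\}$). $E$ is a free $\mathbf{k}$-module with basis $z_1,\dots,z_n$ and $E_i=E/\langle z_{i+1},\dots,z_n\rangle$ for $0\le i\le n$, so $E_\bullet$: $E=E_n\to\cdots\to E_1\to E_0=0$. Flagged Schur modules. Let $F_\bullet=(F_n\to\cdots\to F_1)$ be any flag of quotients of $E$. Put $TE^D=\bigwedge^{r_1}E\otimes\cdots\otimes\bigwedge^{r_m}E$ with $r_j=|a^{(j)}|$; it has basis $z_\tau=\bigotimes_j z_{b^{(j)}_1}\wedge\cdots\wedge z_{b^{(j)}_{r_j}}$, where $\tau=(b^{(1)},\dots,b^{(m)})$, $b^{(j)}=\{b^{(j)}_1<\dots<b^{(j)}_{r_j}\}\subseteq\{1,\dots,n\}$. The $D$-exchange relations are the elements of the kernel of $TE^D\to\mathbf{k}[z_{pq}]_{1\le p,q\le n}$, $z_\tau\mapsto\prod_j\Delta_{a^{(j)},b^{(j)}}$,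 where $\Delta_{a,b}$ is the minor of the generic matrix $(z_{pq})$ on rows $a$ and columns $b$. For $a=\{a_1<\dots<a_r\}$, let $F_\bullet^a$ be the quotient of $\bigwedge^rE$ by the sum over $0\le i<r$ of the images of $\bigwedge^iE\otimes\bigwedge^{r-i}\ker(E\to F_{a_{i+1}})$; put $TF_\bullet^D=\bigotimes_jF_\bullet^{a^{(j)}}$. The flagged Schur module $F_\bullet^D$ is the quotient of $TF_\bullet^D$ by the image of the $D$-exchange relations. It is functorial in $F_\bullet$. Bergeron–Sottile operators on flags: $\mathsf{R}_kE_\bullet$ is the flag with $(\mathsf{R}_kE_\bullet)_i=E_i$ for $i<k$ and $(\mathsf{R}_kE_\bullet)_i=E_{i-1}$ for $i\ge k$. The notation $\mathsf{R}_kE_\bullet^D$ means $(\mathsf{R}_kE_\bullet)^D$. The surjection of flags $\mathsf{R}_{k+1}E_\bullet\to\mathsf{R}_kE_\bullet$ (the projection $E_k\to E_{k-1}$ in position $k$, identity elsewhere) induces the surjection in the statement. *)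

theory Defs
  imports
    "HOL-Algebra.Module"
    "HOL-Algebra.QuotRing"
    "HOL-Algebra.Indexed_Polynomials"
    "HOL-Combinatorics.Permutations"
begin

section \<open>Modules over a commutative ring\<close>

text \<open>The record type of modules extends that of rings; the \<open>mult\<close> and \<open>one\<close> fields play no role
  for modules and are left undefined below.\<close>

definition module_hom ::
    "('a, 'r) ring_scheme \<Rightarrow> ('a, 'b, 'm) module_scheme \<Rightarrow> ('a, 'c, 'k) module_scheme \<Rightarrow> ('b \<Rightarrow> 'c) set"
  where "module_hom R M N =
    {h \<in> carrier M \<rightarrow> carrier N.
       (\<forall>x\<in>carrier M. \<forall>y\<in>carrier M. h (x \<oplus>\<^bsub>M\<^esub> y) = h x \<oplus>\<^bsub>N\<^esub> h y) \<and>
       (\<forall>c\<in>carrier R. \<forall>x\<in>carrier M. h (c \<odot>\<^bsub>M\<^esub> x) = c \<odot>\<^bsub>N\<^esub> h x)}"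

definition module_iso ::
    "('a, 'r) ring_scheme \<Rightarrow> ('a, 'b, 'm) module_scheme \<Rightarrow> ('a, 'c, 'k) module_scheme \<Rightarrow> ('b \<Rightarrow> 'c) set"
  where "module_iso R M N = {h \<in> module_hom R M N. bij_betw h (carrier M) (carrier N)}"

definition submod_gen :: "('a, 'r) ring_scheme \<Rightarrow> ('a, 'b, 'm) module_scheme \<Rightarrow> 'b set \<Rightarrow> 'b set"
  where "submod_gen R M S = \<Inter>{H. submodule H R M \<and> S \<subseteq> H}"

text \<open>\<open>quot_module R M S\<close> is the quotient of \<open>M\<close> by the submodule generated by \<open>S\<close>, as a module of
  cosets, and \<open>quot_proj R M S\<close> is the projection from \<open>M\<close> onto it.\<close>

definition quot_proj :: "('a, 'r) ring_scheme \<Rightarrow> ('a, 'b, 'm) module_scheme \<Rightarrow> 'b set \<Rightarrow> 'b \<Rightarrow> 'b set"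
  where "quot_proj R M S x = submod_gen R M S +>\<^bsub>M\<^esub> x"

definition quot_module ::
    "('a, 'r) ring_scheme \<Rightarrow> ('a, 'b, 'm) module_scheme \<Rightarrow> 'b set \<Rightarrow> ('a, 'b set) module"
  where "quot_module R M S =
    \<lparr>carrier = a_rcosets\<^bsub>M\<^esub> (submod_gen R M S),
     monoid.mult = undefined, one = undefined,
     zero = submod_gen R M S,
     add = set_add M,
     smult = (\<lambda>c Y. \<Union>x\<in>Y. quot_proj R M S (c \<odot>\<^bsub>M\<^esub> x))\<rparr>"

text \<open>The map that \<open>h\<close> induces on a quotient of its domain; meaningful if \<open>h\<close> is constant on cosets.\<close>

definition induced :: "('b \<Rightarrow> 'c) \<Rightarrow> 'b set \<Rightarrow> 'c"
  where "induced h Y = the_elem (h ` Y)"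

text \<open>\<open>z 1, \<dots>, z n\<close> is a basis of \<open>E\<close> (as a family, so that the zero ring is covered too).\<close>

definition is_basis ::
    "('a, 'r) ring_scheme \<Rightarrow> ('a, 'e, 'm) module_scheme \<Rightarrow> nat \<Rightarrow> (nat \<Rightarrow> 'e) \<Rightarrow> bool"
  where "is_basis R E n z \<longleftrightarrow>
    z \<in> {1..n} \<rightarrow> carrier E \<and>
    (\<forall>x\<in>carrier E. \<exists>!c. c \<in> {1..n} \<rightarrow>\<^sub>E carrier R \<and> x = (\<Oplus>\<^bsub>E\<^esub>i\<in>{1..n}. c i \<odot>\<^bsub>E\<^esub> z i))"

section \<open>Tensor products and exterior powers\<close>

definition free_module :: "('a, 'r) ring_scheme \<Rightarrow> 'x set \<Rightarrow> ('a, 'x \<Rightarrow> 'a) module"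
  where "free_module R A =
    \<lparr>carrier = {u. (\<forall>x. u x \<in> carrier R) \<and> {x. u x \<noteq> \<zero>\<^bsub>R\<^esub>} \<subseteq> A \<and> finite {x. u x \<noteq> \<zero>\<^bsub>R\<^esub>}},
     monoid.mult = undefined, one = undefined,
     zero = (\<lambda>x. \<zero>\<^bsub>R\<^esub>),
     add = (\<lambda>u v x. u x \<oplus>\<^bsub>R\<^esub> v x),
     smult = (\<lambda>c u x. c \<otimes>\<^bsub>R\<^esub> u x)\<rparr>"

definition free_gen :: "('a, 'r) ring_scheme \<Rightarrow> 'x \<Rightarrow> 'x \<Rightarrow> 'a"
  where "free_gen R x = (\<lambda>y. if y = x then \<one>\<^bsub>R\<^esub> else \<zero>\<^bsub>R\<^esub>)"

text \<open>The tensor product of a list of modules is the free module on the tuples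
  \<open>(x\<^sub>1, \<dots>, x\<^sub>m)\<close> of elements, modulo the relations making \<open>x\<^sub>1 \<otimes> \<dots> \<otimes> x\<^sub>m\<close> multilinear.
  The tensor product of the empty list is the ring itself.\<close>

definition tensor_gens ::
    "('a, 'r) ring_scheme \<Rightarrow> ('a, 'b, 'm) module_scheme list \<Rightarrow> ('a, 'b list \<Rightarrow> 'a) module"
  where "tensor_gens R Ms = free_module R (listset (map carrier Ms))"

definition tensor_rels ::
    "('a, 'r) ring_scheme \<Rightarrow> ('a, 'b, 'm) module_scheme list \<Rightarrow> ('b list \<Rightarrow> 'a) set"
  where "tensor_rels R Ms =
    {free_gen R (xs[i := x \<oplus>\<^bsub>Ms ! i\<^esub> y])
        \<ominus>\<^bsub>tensor_gens R Ms\<^esub> (free_gen R (xs[i := x]) \<oplus>\<^bsub>tensor_gens R Ms\<^esub> free_gen R (xs[i := y])) |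
      xs i x y. xs \<in> listset (map carrier Ms) \<and> i < length Ms \<and>
                x \<in> carrier (Ms ! i) \<and> y \<in> carrier (Ms ! i)} \<union>
    {free_gen R (xs[i := c \<odot>\<^bsub>Ms ! i\<^esub> x])
        \<ominus>\<^bsub>tensor_gens R Ms\<^esub> (c \<odot>\<^bsub>tensor_gens R Ms\<^esub> free_gen R (xs[i := x])) |
      xs i c x. xs \<in> listset (map carrier Ms) \<and> i < length Ms \<and>
                c \<in> carrier R \<and> x \<in> carrier (Ms ! i)}"

definition tensor ::
    "('a, 'r) ring_scheme \<Rightarrow> ('a, 'b, 'm) module_scheme list \<Rightarrow> ('a, ('b list \<Rightarrow> 'a) set) module"
  where "tensor R Ms = quot_module R (tensor_gens R Ms) (tensor_rels R Ms)"

definition pure_tensor ::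
    "('a, 'r) ring_scheme \<Rightarrow> ('a, 'b, 'm) module_scheme list \<Rightarrow> 'b list \<Rightarrow> ('b list \<Rightarrow> 'a) set"
  where "pure_tensor R Ms xs = quot_proj R (tensor_gens R Ms) (tensor_rels R Ms) (free_gen R xs)"

text \<open>The map \<open>f\<^sub>1 \<otimes> \<dots> \<otimes> f\<^sub>m\<close> into the tensor product of the modules \<open>Ns\<close>: it is induced by the linear
  map on the free module that sends the generator \<open>(x\<^sub>1, \<dots>, x\<^sub>m)\<close> to \<open>f\<^sub>1 x\<^sub>1 \<otimes> \<dots> \<otimes> f\<^sub>m x\<^sub>m\<close>.\<close>

definition tensor_map ::
    "('a, 'r) ring_scheme \<Rightarrow> ('a, 'c, 'm) module_scheme list \<Rightarrow> ('b \<Rightarrow> 'c) list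
      \<Rightarrow> ('b list \<Rightarrow> 'a) set \<Rightarrow> ('c list \<Rightarrow> 'a) set"
  where "tensor_map R Ns fs = induced (\<lambda>u.
    \<Oplus>\<^bsub>tensor R Ns\<^esub>xs\<in>{xs. u xs \<noteq> \<zero>\<^bsub>R\<^esub>}.
      u xs \<odot>\<^bsub>tensor R Ns\<^esub> pure_tensor R Ns (map2 (\<lambda>f x. f x) fs xs))"

text \<open>The \<open>r\<close>-th exterior power is the \<open>r\<close>-th tensor power modulo the pure tensors with a repeated
  entry.\<close>

definition ext_rels ::
    "('a, 'r) ring_scheme \<Rightarrow> ('a, 'b, 'm) module_scheme \<Rightarrow> nat \<Rightarrow> ('b list \<Rightarrow> 'a) set set"
  where "ext_rels R M r =
    {pure_tensor R (replicate r M) xs | xs. length xs = r \<and> set xs \<subseteq> carrier M \<and> \<not> distinct xs}"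

definition ext_power ::
    "('a, 'r) ring_scheme \<Rightarrow> ('a, 'b, 'm) module_scheme \<Rightarrow> nat \<Rightarrow> ('a, ('b list \<Rightarrow> 'a) set set) module"
  where "ext_power R M r = quot_module R (tensor R (replicate r M)) (ext_rels R M r)"

definition wedge ::
    "('a, 'r) ring_scheme \<Rightarrow> ('a, 'b, 'm) module_scheme \<Rightarrow> 'b list \<Rightarrow> ('b list \<Rightarrow> 'a) set set"
  where "wedge R M xs =
    quot_proj R (tensor R (replicate (length xs) M)) (ext_rels R M (length xs))
      (pure_tensor R (replicate (length xs) M) xs)"

section \<open>Minors of the generic matrix\<close>

text \<open>The polynomial algebra on variables indexed by \<open>I\<close>, on the carrier provided by
  HOL-Algebra: monomials are multisets over \<open>I\<close>, polynomials are coefficient functions. That theory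
  has no product of two polynomials; it is supplied here.\<close>

definition poly_algebra :: "('a, 'r) ring_scheme \<Rightarrow> 'v set \<Rightarrow> ('a, 'v multiset \<Rightarrow> 'a) module"
  where "poly_algebra R I =
    \<lparr>carrier = ring.indexed_pset R I (carrier R),
     monoid.mult = (\<lambda>p q m. \<Oplus>\<^bsub>R\<^esub>m1\<in>{m1. m1 \<subseteq># m}. p m1 \<otimes>\<^bsub>R\<^esub> q (m - m1)),
     one = ring.indexed_const R \<one>\<^bsub>R\<^esub>,
     zero = ring.indexed_const R \<zero>\<^bsub>R\<^esub>,
     add = ring.indexed_padd R,
     smult = (\<lambda>c p m. c \<otimes>\<^bsub>R\<^esub> p m)\<rparr>"

definition generic_poly ::
    "('a, 'r) ring_scheme \<Rightarrow> nat \<Rightarrow> ('a, (nat \<times> nat) multiset \<Rightarrow> 'a) module"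
  where "generic_poly R n = poly_algebra R ({1..n} \<times> {1..n})"

definition generic_minor ::
    "('a, 'r) ring_scheme \<Rightarrow> nat \<Rightarrow> nat set \<Rightarrow> nat set \<Rightarrow> (nat \<times> nat) multiset \<Rightarrow> 'a"
  where "generic_minor R n a b =
    (\<Oplus>\<^bsub>generic_poly R n\<^esub>\<sigma>\<in>{\<sigma>. \<sigma> permutes {..<card a}}.
      (let p = (\<Otimes>\<^bsub>generic_poly R n\<^esub>i\<in>{..<card a}.
                  ring.indexed_var R (sorted_list_of_set a ! i, sorted_list_of_set b ! \<sigma> i))
       in if evenperm \<sigma> then p else \<ominus>\<^bsub>generic_poly R n\<^esub> p))"

section \<open>Diagrams and the exchange relations\<close>

text \<open>A diagram is given by the list of its columns.\<close>

type_synonym diagram = "nat set list"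

definition in_rows :: "nat \<Rightarrow> diagram \<Rightarrow> bool"
  where "in_rows n D \<longleftrightarrow> (\<forall>a\<in>set D. a \<subseteq> {1..n})"

definition k_full :: "nat \<Rightarrow> diagram \<Rightarrow> bool"
  where "k_full k D \<longleftrightarrow> (\<forall>a\<in>set D. k \<in> a \<longrightarrow> k + 1 \<in> a)"

definition TE :: "('a, 'r) ring_scheme \<Rightarrow> ('a, 'e, 'm) module_scheme \<Rightarrow> diagram
    \<Rightarrow> ('a, (('e list \<Rightarrow> 'a) set set list \<Rightarrow> 'a) set) module"
  where "TE R E D = tensor R (map (\<lambda>a. ext_power R E (card a)) D)"

definition fillings :: "nat \<Rightarrow> diagram \<Rightarrow> nat set list set"
  where "fillings n D =
    {\<tau>. length \<tau> = length D \<and> (\<forall>j<length D. \<tau> ! j \<subseteq> {1..n} \<and> card (\<tau> ! j) = card (D ! j))}"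

definition TE_basis :: "('a, 'r) ring_scheme \<Rightarrow> ('a, 'e, 'm) module_scheme \<Rightarrow> (nat \<Rightarrow> 'e) \<Rightarrow> diagram
    \<Rightarrow> nat set list \<Rightarrow> (('e list \<Rightarrow> 'a) set set list \<Rightarrow> 'a) set"
  where "TE_basis R E z D \<tau> =
    pure_tensor R (map (\<lambda>a. ext_power R E (card a)) D)
      (map (\<lambda>b. wedge R E (map z (sorted_list_of_set b))) \<tau>)"

definition minor_product ::
    "('a, 'r) ring_scheme \<Rightarrow> nat \<Rightarrow> diagram \<Rightarrow> nat set list \<Rightarrow> (nat \<times> nat) multiset \<Rightarrow> 'a"
  where "minor_product R n D \<tau> =
    (\<Otimes>\<^bsub>generic_poly R n\<^esub>j\<in>{..<length D}. generic_minor R n (D ! j) (\<tau> ! j))"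

text \<open>Kernel of the linear map sending the basis element \<open>z\<^sub>\<tau>\<close> to the product of minors
  \<open>\<Delta>\<close> of the columns of \<open>\<tau>\<close>: the element \<open>\<Sum> c\<^sub>\<tau> z\<^sub>\<tau>\<close> is mapped to \<open>\<Sum> c\<^sub>\<tau> \<Prod> \<Delta>\<close>.\<close>

definition exchange_rels ::
    "('a, 'r) ring_scheme \<Rightarrow> ('a, 'e, 'm) module_scheme \<Rightarrow> nat \<Rightarrow> (nat \<Rightarrow> 'e) \<Rightarrow> diagram
      \<Rightarrow> (('e list \<Rightarrow> 'a) set set list \<Rightarrow> 'a) set set"
  where "exchange_rels R E n z D =
    {(\<Oplus>\<^bsub>TE R E D\<^esub>\<tau>\<in>fillings n D. c \<tau> \<odot>\<^bsub>TE R E D\<^esub> TE_basis R E z D \<tau>) | c.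
      c \<in> fillings n D \<rightarrow> carrier R \<and>
      (\<Oplus>\<^bsub>generic_poly R n\<^esub>\<tau>\<in>fillings n D. c \<tau> \<odot>\<^bsub>generic_poly R n\<^esub> minor_product R n D \<tau>)
        = \<zero>\<^bsub>generic_poly R n\<^esub>}"

section \<open>Flags and flagged Schur modules\<close>

text \<open>A flag of quotients of \<open>E\<close> gives, in each position \<open>i\<close>, the quotient \<open>F\<^sub>i\<close> together with the
  surjection \<open>E \<rightarrow> F\<^sub>i\<close>. The maps \<open>F\<^sub>i\<^sub>+\<^sub>1 \<rightarrow> F\<^sub>i\<close> are determined by these.\<close>

type_synonym ('a, 'e, 'f) flag = "nat \<Rightarrow> ('a, 'f) module \<times> ('e \<Rightarrow> 'f)"

definition standard_flag :: "('a, 'r) ring_scheme \<Rightarrow> ('a, 'e, 'm) module_scheme \<Rightarrow> nat \<Rightarrow> (nat \<Rightarrow> 'e)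
    \<Rightarrow> ('a, 'e, 'e set) flag"
  where "standard_flag R E n z i = (quot_module R E (z ` {i<..n}), quot_proj R E (z ` {i<..n}))"

definition BS_op :: "nat \<Rightarrow> ('a, 'e, 'f) flag \<Rightarrow> ('a, 'e, 'f) flag"
  where "BS_op k F i = (if i < k then F i else F (i - 1))"

text \<open>The image of \<open>\<And>\<^sup>i E \<otimes> \<And>\<^sup>r\<^sup>-\<^sup>i K\<close> in \<open>\<And>\<^sup>r E\<close> is generated by the \<open>x\<^sub>1 \<and> \<dots> \<and> x\<^sub>r\<close> whose last
  \<open>r - i\<close> factors are in \<open>K\<close>; here \<open>K\<close> is the kernel of \<open>E \<rightarrow> F\<^sub>p\<close> with \<open>p = a\<^sub>i\<^sub>+\<^sub>1\<close>. List indices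
  start at 0.\<close>

definition column_rels :: "('a, 'r) ring_scheme \<Rightarrow> ('a, 'e, 'm) module_scheme \<Rightarrow> ('a, 'e, 'f) flag
    \<Rightarrow> nat set \<Rightarrow> ('e list \<Rightarrow> 'a) set set set"
  where "column_rels R E F a =
    {wedge R E xs | xs i. length xs = card a \<and> set xs \<subseteq> carrier E \<and> i < card a \<and>
      (let (Q, \<pi>) = F (sorted_list_of_set a ! i)
       in \<forall>j\<in>{i..<card a}. xs ! j \<in> a_kernel E Q \<pi>)}"

definition column_module :: "('a, 'r) ring_scheme \<Rightarrow> ('a, 'e, 'm) module_scheme \<Rightarrow> ('a, 'e, 'f) flag
    \<Rightarrow> nat set \<Rightarrow> ('a, ('e list \<Rightarrow> 'a) set set set) module"
  where "column_module R E F a = quot_module R (ext_power R E (card a)) (column_rels R E F a)"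

definition column_proj :: "('a, 'r) ring_scheme \<Rightarrow> ('a, 'e, 'm) module_scheme \<Rightarrow> ('a, 'e, 'f) flag
    \<Rightarrow> nat set \<Rightarrow> ('e list \<Rightarrow> 'a) set set \<Rightarrow> ('e list \<Rightarrow> 'a) set set set"
  where "column_proj R E F a = quot_proj R (ext_power R E (card a)) (column_rels R E F a)"

definition TF :: "('a, 'r) ring_scheme \<Rightarrow> ('a, 'e, 'm) module_scheme \<Rightarrow> ('a, 'e, 'f) flag \<Rightarrow> diagram
    \<Rightarrow> ('a, (('e list \<Rightarrow> 'a) set set set list \<Rightarrow> 'a) set) module"
  where "TF R E F D = tensor R (map (column_module R E F) D)"

definition TE_to_TF :: "('a, 'r) ring_scheme \<Rightarrow> ('a, 'e, 'm) module_scheme \<Rightarrow> ('a, 'e, 'f) flag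
    \<Rightarrow> diagram \<Rightarrow> (('e list \<Rightarrow> 'a) set set list \<Rightarrow> 'a) set
    \<Rightarrow> (('e list \<Rightarrow> 'a) set set set list \<Rightarrow> 'a) set"
  where "TE_to_TF R E F D =
    tensor_map R (map (column_module R E F) D) (map (column_proj R E F) D)"

definition schur_module :: "('a, 'r) ring_scheme \<Rightarrow> ('a, 'e, 'm) module_scheme \<Rightarrow> nat \<Rightarrow> (nat \<Rightarrow> 'e)
    \<Rightarrow> ('a, 'e, 'f) flag \<Rightarrow> diagram
    \<Rightarrow> ('a, (('e list \<Rightarrow> 'a) set set set list \<Rightarrow> 'a) set set) module"
  where "schur_module R E n z F D =
    quot_module R (TF R E F D) (TE_to_TF R E F D ` exchange_rels R E n z D)"

definition schur_proj :: "('a, 'r) ring_scheme \<Rightarrow> ('a, 'e, 'm) module_scheme \<Rightarrow> nat \<Rightarrow> (nat \<Rightarrow> 'e)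
    \<Rightarrow> ('a, 'e, 'f) flag \<Rightarrow> diagram \<Rightarrow> (('e list \<Rightarrow> 'a) set set set list \<Rightarrow> 'a) set
    \<Rightarrow> (('e list \<Rightarrow> 'a) set set set list \<Rightarrow> 'a) set set"
  where "schur_proj R E n z F D =
    quot_proj R (TF R E F D) (TE_to_TF R E F D ` exchange_rels R E n z D)"

text \<open>Functoriality. A map of flags \<open>F \<rightarrow> G\<close> under \<open>E\<close> is unique, and exists iff
  \<open>ker (E \<rightarrow> F\<^sub>i) \<subseteq> ker (E \<rightarrow> G\<^sub>i)\<close> for all \<open>i\<close>; the identity of \<open>\<And>\<^sup>r E\<close> then induces the maps from
  \<open>F\<^sup>a\<close> to \<open>G\<^sup>a\<close>, whose tensor product induces the map of flagged Schur modules. The source flag \<open>F\<close>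
  enters only through the elements (cosets) to which the map is applied.\<close>

definition column_map :: "('a, 'r) ring_scheme \<Rightarrow> ('a, 'e, 'm) module_scheme \<Rightarrow> ('a, 'e, 'f) flag
    \<Rightarrow> nat set \<Rightarrow> ('e list \<Rightarrow> 'a) set set set \<Rightarrow> ('e list \<Rightarrow> 'a) set set set"
  where "column_map R E G a = induced (column_proj R E G a)"

definition schur_map :: "('a, 'r) ring_scheme \<Rightarrow> ('a, 'e, 'm) module_scheme \<Rightarrow> nat \<Rightarrow> (nat \<Rightarrow> 'e)
    \<Rightarrow> ('a, 'e, 'f) flag \<Rightarrow> diagram \<Rightarrow> (('e list \<Rightarrow> 'a) set set set list \<Rightarrow> 'a) set set
    \<Rightarrow> (('e list \<Rightarrow> 'a) set set set list \<Rightarrow> 'a) set set"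
  where "schur_map R E n z G D =
    induced (schur_proj R E n z G D \<circ>
      tensor_map R (map (column_module R E G) D) (map (column_map R E G) D))"

end

theory Submission
  imports Defs
begin

text \<open>The two flags differ only in position \<open>k\<close>, so only a column \<open>a\<close> with \<open>k \<in> a\<close> matters, and then
  \<open>k + 1 \<in> a\<close> as well. Say that \<open>k\<close> and \<open>k + 1\<close> are the \<open>p\<close>-th and \<open>(p + 1)\<close>-st elements of \<open>a\<close>, and write
  \<open>K\<^sub>i\<close> for the kernel of \<open>E \<rightarrow> E\<^sub>i\<close>. For both flags the row \<open>k + 1\<close> kills the wedges whose factors at
  positions \<open>> p\<close> are in \<open>K\<^sub>k\<close>. The row \<open>k\<close> of \<open>R\<^sub>k\<close> kills those whose factors at positions \<open>\<ge> p\<close> are in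
  \<open>K\<^sub>k\<^sub>-\<^sub>1 = \<langle>z\<^sub>k\<rangle> + K\<^sub>k\<close>; as at most one factor can be \<open>z\<^sub>k\<close>, and it can be moved to position \<open>p\<close>,
  these are already killed. Hence both flags have the same column relations, the two Schur modules
  are equal, and the natural surjection is the identity.\<close>

section \<open>Module homomorphisms and quotients\<close>

lemma module_homI:
  assumes "\<And>x. x \<in> carrier M \<Longrightarrow> h x \<in> carrier N"
    and "\<And>x y. \<lbrakk>x \<in> carrier M; y \<in> carrier M\<rbrakk> \<Longrightarrow> h (x \<oplus>\<^bsub>M\<^esub> y) = h x \<oplus>\<^bsub>N\<^esub> h y"
    and "\<And>c x. \<lbrakk>c \<in> carrier R; x \<in> carrier M\<rbrakk> \<Longrightarrow> h (c \<odot>\<^bsub>M\<^esub> x) = c \<odot>\<^bsub>N\<^esub> h x"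
  shows "h \<in> module_hom R M N"
  using assms by (auto simp: module_hom_def)

lemma module_homD:
  assumes "h \<in> module_hom R M N"
  shows module_hom_closed: "x \<in> carrier M \<Longrightarrow> h x \<in> carrier N"
    and module_hom_add: "\<lbrakk>x \<in> carrier M; y \<in> carrier M\<rbrakk> \<Longrightarrow> h (x \<oplus>\<^bsub>M\<^esub> y) = h x \<oplus>\<^bsub>N\<^esub> h y"
    and module_hom_smult: "\<lbrakk>c \<in> carrier R; x \<in> carrier M\<rbrakk> \<Longrightarrow> h (c \<odot>\<^bsub>M\<^esub> x) = c \<odot>\<^bsub>N\<^esub> h x"
  using assms by (auto simp: module_hom_def)

text \<open>Makes the library facts on homomorphisms of abelian groups, such as preservation of zero
  and of negatives, available for \<open>module_hom\<close>, which only demands compatibility with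
  sums and scalars.\<close>

lemma abelian_group_hom_module_hom:
  assumes "module R M" "module R N" "h \<in> module_hom R M N"
  shows "abelian_group_hom M N h"
proof -
  interpret M: module R M by fact
  interpret N: module R N by fact
  show ?thesis
  proof (rule abelian_group_homI)
    show "group_hom (add_monoid M) (add_monoid N) h"
      by (intro group_hom.intro group_hom_axioms.intro M.add.is_group N.add.is_group)
        (use assms(3) in \<open>auto simp: module_hom_def hom_def\<close>)
  qed (rule M.abelian_group_axioms N.abelian_group_axioms)+
qed

lemma module_hom_finsum:
  assumes "module R M" "module R N" "h \<in> module_hom R M N" "finite B" "f \<in> B \<rightarrow> carrier M"
  shows "h (\<Oplus>\<^bsub>M\<^esub>x\<in>B. f x) = (\<Oplus>\<^bsub>N\<^esub>x\<in>B. h (f x))"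
proof -
  interpret M: module R M by fact
  interpret N: module R N by fact
  interpret h: abelian_group_hom M N h using assms by (intro abelian_group_hom_module_hom)
  show ?thesis
    using assms(4,5)
    by (induct B rule: finite_induct) (auto simp: Pi_def M.finsum_insert N.finsum_insert)
qed

section \<open>Generated submodules and the quotients by them\<close>

context module
begin

lemma abelian_subgroup_submodule: "submodule H R M \<Longrightarrow> abelian_subgroup H M"
  by (intro abelian_subgroupI3 additive_subgroupI submodule.axioms(1) M.abelian_group_axioms)

lemma submodule_zero: "submodule H R M \<Longrightarrow> \<zero>\<^bsub>M\<^esub> \<in> H"
  using additive_subgroup.zero_closed[OF abelian_subgroup.axioms(1)[OF abelian_subgroup_submodule]] .

lemma submod_gen_incl: "S \<subseteq> submod_gen R M S"
  by (auto simp: submod_gen_def)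

lemma submod_gen_least: "\<lbrakk>submodule H R M; S \<subseteq> H\<rbrakk> \<Longrightarrow> submod_gen R M S \<subseteq> H"
  by (auto simp: submod_gen_def)

text \<open>An intersection of submodules is one; \<open>S \<subseteq> carrier M\<close> puts
  \<open>M\<close> itself into the family, hence the intersection inside the carrier.\<close>

lemma submodule_submod_gen:
  assumes "S \<subseteq> carrier M"
  shows "submodule (submod_gen R M S) R M"
proof (rule submoduleI)
  show "submod_gen R M S \<subseteq> carrier M"
    using assms carrier_is_submodule by (intro submod_gen_least)
qed (auto simp: submod_gen_def submodule_zero dest: submoduleE)

text \<open>By minimality, two generated submodules can be compared on generators alone. The column
  relations of the two flags are compared in this way.\<close>

lemma submod_gen_eqI:
  assumes "S \<subseteq> carrier M" "T \<subseteq> carrier M" "S \<subseteq> submod_gen R M T" "T \<subseteq> submod_gen R M S"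
  shows "submod_gen R M S = submod_gen R M T"
  using assms by (intro equalityI submod_gen_least submodule_submod_gen)

lemma submod_gen_mono: "S \<subseteq> T \<Longrightarrow> submod_gen R M S \<subseteq> submod_gen R M T"
  by (auto simp: submod_gen_def)

text \<open>Together with \<open>submod_gen_least\<close> this shows that a linear map killing a set
  of generators kills everything they generate.\<close>

lemma submodule_vimage_zero:
  assumes "module R N" "h \<in> module_hom R M N"
  shows "submodule {x \<in> carrier M. h x = \<zero>\<^bsub>N\<^esub>} R M"
proof -
  interpret N: module R N by fact
  interpret h: abelian_group_hom M N h
    using assms module_axioms by (intro abelian_group_hom_module_hom)
  show ?thesis
    by (rule submoduleI) (auto simp: module_hom_smult[OF assms(2)])
qed

context
  fixes S
  assumes S: "S \<subseteq> carrier M"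
begin

interpretation H: abelian_subgroup "submod_gen R M S" M
  by (rule abelian_subgroup_submodule[OF submodule_submod_gen[OF S]])

lemma quot_proj_eqI:
  "\<lbrakk>x \<in> carrier M; y \<in> carrier M; x \<ominus>\<^bsub>M\<^esub> y \<in> submod_gen R M S\<rbrakk>
    \<Longrightarrow> quot_proj R M S x = quot_proj R M S y"
  unfolding quot_proj_def
  using H.a_repr_independence'[of x y] H.a_rcos_module_rev[of y x] by (simp add: M.minus_eq)

lemma quot_proj_mem: "\<lbrakk>x \<in> carrier M; y \<in> quot_proj R M S x\<rbrakk>
    \<Longrightarrow> y \<in> carrier M \<and> y \<ominus>\<^bsub>M\<^esub> x \<in> submod_gen R M S"
  unfolding quot_proj_def
  using H.a_elemrcos_carrier H.a_rcos_module_imp by (auto simp: M.minus_eq)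

lemma quot_proj_self: "x \<in> carrier M \<Longrightarrow> x \<in> quot_proj R M S x"
  unfolding quot_proj_def by (rule H.a_rcos_self)

lemma carrier_quot_module: "carrier (quot_module R M S) = quot_proj R M S ` carrier M"
  by (auto simp: quot_module_def quot_proj_def A_RCOSETS_def')

lemma quot_proj_add:
  "\<lbrakk>x \<in> carrier M; y \<in> carrier M\<rbrakk> \<Longrightarrow>
    quot_proj R M S x \<oplus>\<^bsub>quot_module R M S\<^esub> quot_proj R M S y = quot_proj R M S (x \<oplus>\<^bsub>M\<^esub> y)"
  unfolding quot_module_def quot_proj_def by (simp add: H.a_rcos_sum)

lemma quot_proj_zero: "\<zero>\<^bsub>quot_module R M S\<^esub> = quot_proj R M S \<zero>\<^bsub>M\<^esub>"
  unfolding quot_module_def quot_proj_def by (simp add: H.a_rcos_const)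

lemma quot_proj_smult:
  assumes "c \<in> carrier R" "x \<in> carrier M"
  shows "c \<odot>\<^bsub>quot_module R M S\<^esub> quot_proj R M S x = quot_proj R M S (c \<odot>\<^bsub>M\<^esub> x)"
proof -
  \<comment> \<open>All representatives of a coset give the same scaled coset, as their differences
    stay in the submodule after scaling; so the union in the definition of \<open>smult\<close> is
    that single coset.\<close>
  have "quot_proj R M S (c \<odot>\<^bsub>M\<^esub> y) = quot_proj R M S (c \<odot>\<^bsub>M\<^esub> x)" if y: "y \<in> quot_proj R M S x" for y
  proof (rule quot_proj_eqI)
    have y: "y \<in> carrier M" "y \<ominus>\<^bsub>M\<^esub> x \<in> submod_gen R M S"
      using quot_proj_mem assms y by auto
    then have "c \<odot>\<^bsub>M\<^esub> (y \<ominus>\<^bsub>M\<^esub> x) \<in> submod_gen R M S"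
      using assms submoduleE(4)[OF submodule_submod_gen[OF S]] by blast
    then show "c \<odot>\<^bsub>M\<^esub> y \<ominus>\<^bsub>M\<^esub> c \<odot>\<^bsub>M\<^esub> x \<in> submod_gen R M S"
      using assms y by (simp add: M.minus_eq smult_r_distr smult_r_minus)
    show "c \<odot>\<^bsub>M\<^esub> y \<in> carrier M" "c \<odot>\<^bsub>M\<^esub> x \<in> carrier M"
      using assms y by auto
  qed
  then have "(\<Union>y\<in>quot_proj R M S x. quot_proj R M S (c \<odot>\<^bsub>M\<^esub> y)) = quot_proj R M S (c \<odot>\<^bsub>M\<^esub> x)"
    using quot_proj_self[OF assms(2)] by blast
  then show ?thesis by (simp add: quot_module_def)
qed

lemma module_quot_module: "module R (quot_module R M S)"
proof (rule moduleI)
  show "cring R" by (rule R.is_cring)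
  show "abelian_group (quot_module R M S)"
  proof (rule abelian_groupI)
    fix Y assume "Y \<in> carrier (quot_module R M S)"
    then obtain x where x: "x \<in> carrier M" "Y = quot_proj R M S x"
      by (auto simp: carrier_quot_module)
    then show "\<exists>Z\<in>carrier (quot_module R M S).
        Z \<oplus>\<^bsub>quot_module R M S\<^esub> Y = \<zero>\<^bsub>quot_module R M S\<^esub>"
      by (intro bexI[of _ "quot_proj R M S (\<ominus>\<^bsub>M\<^esub> x)"])
        (auto simp: carrier_quot_module quot_proj_add quot_proj_zero M.l_neg)
  qed (auto simp: carrier_quot_module quot_proj_add quot_proj_zero M.a_ac)
qed (auto simp: carrier_quot_module quot_proj_add quot_proj_smult smult_l_distr smult_r_distr
       smult_assoc1)

lemma quot_proj_hom: "quot_proj R M S \<in> module_hom R M (quot_module R M S)"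
  by (rule module_homI) (auto simp: carrier_quot_module quot_proj_add quot_proj_smult)

lemma quot_proj_eq_zero_iff:
  assumes "x \<in> carrier M"
  shows "quot_proj R M S x = \<zero>\<^bsub>quot_module R M S\<^esub> \<longleftrightarrow> x \<in> submod_gen R M S"
  using H.a_rcos_self[OF assms] H.a_rcos_const[of x]
  by (auto simp only: quot_proj_def quot_module_def ring.simps)

lemma quot_proj_gen: "x \<in> S \<Longrightarrow> quot_proj R M S x = \<zero>\<^bsub>quot_module R M S\<^esub>"
  using S submod_gen_incl[of S] quot_proj_eq_zero_iff[of x] by blast

lemma quot_proj_eq_if_minus_gen:
  assumes "x \<in> carrier M" "y \<in> carrier M" "x \<ominus>\<^bsub>M\<^esub> y \<in> S"
  shows "quot_proj R M S x = quot_proj R M S y"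
  using assms submod_gen_incl by (intro quot_proj_eqI) auto

text \<open>The universal property of the quotient: the kernel of \<open>h\<close> is a submodule
  containing \<open>S\<close>, hence all of \<open>submod_gen R M S\<close>, so \<open>h\<close> is
  constant on the coset of \<open>x\<close> and \<open>the_elem\<close> returns that
  constant.\<close>

lemma induced_quot_proj:
  assumes "module R N" "h \<in> module_hom R M N" "\<And>x. x \<in> S \<Longrightarrow> h x = \<zero>\<^bsub>N\<^esub>" "x \<in> carrier M"
  shows "induced h (quot_proj R M S x) = h x"
proof -
  interpret N: module R N by fact
  interpret h: abelian_group_hom M N h
    using assms module_axioms by (intro abelian_group_hom_module_hom)
  have *: "submod_gen R M S \<subseteq> {x \<in> carrier M. h x = \<zero>\<^bsub>N\<^esub>}"
    using S assms(3) by (intro submod_gen_least submodule_vimage_zero[OF assms(1,2)]) auto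
  have "h y = h x" if y: "y \<in> quot_proj R M S x" for y
  proof -
    have y: "y \<in> carrier M" "y \<ominus>\<^bsub>M\<^esub> x \<in> submod_gen R M S"
      using quot_proj_mem assms(4) y by auto
    then have "h y \<oplus>\<^bsub>N\<^esub> \<ominus>\<^bsub>N\<^esub> h x = \<zero>\<^bsub>N\<^esub>"
      using * assms(4) by (auto simp: M.minus_eq)
    \<comment> \<open>Uniqueness of negatives: \<open>h y\<close> and \<open>h x\<close> are both
      inverse to the negative of \<open>h x\<close>.\<close>
    then show ?thesis using y assms(4)
      using N.minus_equality[of "h y" "\<ominus>\<^bsub>N\<^esub> h x"] by simp
  qed
  then have "h ` quot_proj R M S x = (\<lambda>_. h x) ` quot_proj R M S x"
    by (intro image_cong refl)
  also have "\<dots> = {h x}"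
    using quot_proj_self[OF assms(4)] by blast
  finally have "h ` quot_proj R M S x = {h x}" .
  then show ?thesis by (simp add: induced_def)
qed

lemma induced_hom:
  assumes "module R N" "h \<in> module_hom R M N" "\<And>x. x \<in> S \<Longrightarrow> h x = \<zero>\<^bsub>N\<^esub>"
  shows "induced h \<in> module_hom R (quot_module R M S) N"
  by (intro module_homI)
    (auto simp: carrier_quot_module quot_proj_add quot_proj_smult induced_quot_proj[OF assms]
       module_homD[OF assms(2)])

text \<open>A projection is constant on each of its cosets, with that coset as value. This is what
  turns the induced maps between equal quotients into identities.\<close>

lemma induced_quot_proj_self:
  assumes "Y \<in> carrier (quot_module R M S)"
  shows "induced (quot_proj R M S) Y = Y"
proof -
  obtain x where "x \<in> carrier M" "Y = quot_proj R M S x"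
    using assms by (auto simp: carrier_quot_module)
  then show ?thesis
    using induced_quot_proj[OF module_quot_module quot_proj_hom quot_proj_gen] by blast
qed

text \<open>Maps on a quotient are compared on the representatives of a coset, so these have to be
  known as elements of \<open>M\<close>.\<close>

lemma quot_module_subset_carrier: "Y \<in> carrier (quot_module R M S) \<Longrightarrow> Y \<subseteq> carrier M"
  unfolding carrier_quot_module using quot_proj_mem by blast

text \<open>Lets the kernels in \<open>column_rels\<close> be replaced by generated submodules when
  the flag consists of quotient projections.\<close>

lemma a_kernel_quot_proj: "a_kernel M (quot_module R M S) (quot_proj R M S) = submod_gen R M S"
  unfolding a_kernel_def'
  using submoduleE(1)[OF submodule_submod_gen[OF S]] quot_proj_eq_zero_iff by blast

end

end

lemma induced_cong: "(\<And>y. y \<in> Y \<Longrightarrow> h y = g y) \<Longrightarrow> induced h Y = induced g Y"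
  by (simp add: induced_def cong: image_cong)

section \<open>Free modules\<close>

lemma free_module_simps:
  "zero (free_module R A) = (\<lambda>x. \<zero>\<^bsub>R\<^esub>)"
  "u \<oplus>\<^bsub>free_module R A\<^esub> v = (\<lambda>x. u x \<oplus>\<^bsub>R\<^esub> v x)"
  "c \<odot>\<^bsub>free_module R A\<^esub> u = (\<lambda>x. c \<otimes>\<^bsub>R\<^esub> u x)"
  by (simp_all add: free_module_def)

lemma carrier_free_module:
  "u \<in> carrier (free_module R A) \<longleftrightarrow>
    (\<forall>x. u x \<in> carrier R) \<and> {x. u x \<noteq> \<zero>\<^bsub>R\<^esub>} \<subseteq> A \<and> finite {x. u x \<noteq> \<zero>\<^bsub>R\<^esub>}"
  by (simp add: free_module_def)

lemma module_free_module:
  assumes "cring R"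
  shows "module R (free_module R A)"
proof -
  interpret cring R by fact
  have fin: "finite {x. f x \<noteq> \<zero>\<^bsub>R\<^esub>}"
    if "finite {x. u x \<noteq> \<zero>\<^bsub>R\<^esub>}" "finite {x. v x \<noteq> \<zero>\<^bsub>R\<^esub>}"
      "\<And>x. u x = \<zero>\<^bsub>R\<^esub> \<Longrightarrow> v x = \<zero>\<^bsub>R\<^esub> \<Longrightarrow> f x = \<zero>\<^bsub>R\<^esub>" for f u v :: "'c \<Rightarrow> _"
    by (rule finite_subset[OF _ finite_UnI[OF that(1,2)]]) (use that(3) in auto)
  let ?F = "free_module R A"
  have val: "u x \<in> carrier R" "x \<notin> A \<Longrightarrow> u x = \<zero>\<^bsub>R\<^esub>" "finite {x. u x \<noteq> \<zero>\<^bsub>R\<^esub>}"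
    if "u \<in> carrier ?F" for u x
    using that by (auto simp: carrier_free_module)
  have memI: "u \<in> carrier ?F"
    if "\<And>x. u x \<in> carrier R" "\<And>x. x \<notin> A \<Longrightarrow> u x = \<zero>\<^bsub>R\<^esub>" "finite {x. u x \<noteq> \<zero>\<^bsub>R\<^esub>}" for u
    using that by (auto simp: carrier_free_module)
  have add: "u \<oplus>\<^bsub>?F\<^esub> v \<in> carrier ?F" if "u \<in> carrier ?F" "v \<in> carrier ?F" for u v
    using val[OF that(1)] val[OF that(2)] fin[of u v "\<lambda>x. u x \<oplus>\<^bsub>R\<^esub> v x"]
    by (intro memI) (simp_all add: free_module_simps)
  have smult: "c \<odot>\<^bsub>?F\<^esub> u \<in> carrier ?F" if "u \<in> carrier ?F" "c \<in> carrier R" for u c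
    using val[OF that(1)] that(2) fin[of u u "\<lambda>x. c \<otimes>\<^bsub>R\<^esub> u x"]
    by (intro memI) (simp_all add: free_module_simps)
  show ?thesis
  proof (rule moduleI)
    show "cring R" by fact
    show "abelian_group ?F"
    proof (rule abelian_groupI)
      show "\<zero>\<^bsub>?F\<^esub> \<in> carrier ?F" by (rule memI) (simp_all add: free_module_simps)
    next
      fix u assume u: "u \<in> carrier ?F"
      show "\<zero>\<^bsub>?F\<^esub> \<oplus>\<^bsub>?F\<^esub> u = u" by (simp add: free_module_simps val[OF u])
      \<comment> \<open>The negative of \<open>u\<close> is taken to be \<open>-1\<close> times
        \<open>u\<close>, so that its finite support comes from closure under scalars.\<close>
      have "(\<ominus>\<^bsub>R\<^esub> \<one>\<^bsub>R\<^esub>) \<odot>\<^bsub>?F\<^esub> u \<oplus>\<^bsub>?F\<^esub> u = \<zero>\<^bsub>?F\<^esub>"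
        by (simp add: free_module_simps val[OF u] l_minus l_neg)
      then show "\<exists>v\<in>carrier ?F. v \<oplus>\<^bsub>?F\<^esub> u = \<zero>\<^bsub>?F\<^esub>"
        using smult[OF u, of "\<ominus>\<^bsub>R\<^esub> \<one>\<^bsub>R\<^esub>"] by blast
      fix v assume v: "v \<in> carrier ?F"
      show "u \<oplus>\<^bsub>?F\<^esub> v \<in> carrier ?F" using u v by (rule add)
      show "u \<oplus>\<^bsub>?F\<^esub> v = v \<oplus>\<^bsub>?F\<^esub> u" by (simp add: free_module_simps val[OF u] val[OF v] a_comm)
      fix w assume w: "w \<in> carrier ?F"
      show "u \<oplus>\<^bsub>?F\<^esub> v \<oplus>\<^bsub>?F\<^esub> w = u \<oplus>\<^bsub>?F\<^esub> (v \<oplus>\<^bsub>?F\<^esub> w)"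
        by (simp add: free_module_simps val[OF u] val[OF v] val[OF w] a_assoc)
    qed
  next
    fix c u assume c: "c \<in> carrier R" and u: "u \<in> carrier ?F"
    show "c \<odot>\<^bsub>?F\<^esub> u \<in> carrier ?F" using u c by (rule smult)
    show "(c \<oplus>\<^bsub>R\<^esub> d) \<odot>\<^bsub>?F\<^esub> u = c \<odot>\<^bsub>?F\<^esub> u \<oplus>\<^bsub>?F\<^esub> d \<odot>\<^bsub>?F\<^esub> u"
      "(c \<otimes>\<^bsub>R\<^esub> d) \<odot>\<^bsub>?F\<^esub> u = c \<odot>\<^bsub>?F\<^esub> (d \<odot>\<^bsub>?F\<^esub> u)" if "d \<in> carrier R" for d
      using c that by (simp_all add: free_module_simps val[OF u] l_distr m_assoc)
    show "c \<odot>\<^bsub>?F\<^esub> (u \<oplus>\<^bsub>?F\<^esub> v) = c \<odot>\<^bsub>?F\<^esub> u \<oplus>\<^bsub>?F\<^esub> c \<odot>\<^bsub>?F\<^esub> v" if v: "v \<in> carrier ?F" for v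
      using c by (simp add: free_module_simps val[OF u] val[OF v] r_distr)
  next
    show "\<one>\<^bsub>R\<^esub> \<odot>\<^bsub>?F\<^esub> u = u" if u: "u \<in> carrier ?F" for u
      by (simp add: free_module_simps val[OF u])
  qed
qed

lemma free_gen_closed: "\<lbrakk>cring R; x \<in> A\<rbrakk> \<Longrightarrow> free_gen R x \<in> carrier (free_module R A)"
  by (auto simp: carrier_free_module free_gen_def cring.cring_simprules(2,6)
      intro: finite_subset[of _ "{x}"])

text \<open>The linear extension of \<open>f\<close> from the free generators. The sum over the
  support has the same shape as the body of \<open>tensor_map\<close>, so that unfolding exhibits
  \<open>tensor_map\<close> as an induced linear extension.\<close>

definition lin_ext ::
    "('a, 'r) ring_scheme \<Rightarrow> ('a, 'b, 'm) module_scheme \<Rightarrow> ('x \<Rightarrow> 'b) \<Rightarrow> ('x \<Rightarrow> 'a) \<Rightarrow> 'b"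
  where "lin_ext R N f u = (\<Oplus>\<^bsub>N\<^esub>x\<in>{x. u x \<noteq> \<zero>\<^bsub>R\<^esub>}. u x \<odot>\<^bsub>N\<^esub> f x)"

context module
begin

text \<open>Outside the support the coefficients are zero, and \<open>B \<subseteq> A\<close> keeps
  the values of \<open>f\<close> in \<open>M\<close>. A larger index set is needed to add sums with
  different supports.\<close>

lemma lin_ext_superset:
  assumes "u \<in> carrier (free_module R A)" "f \<in> A \<rightarrow> carrier M"
    "finite B" "{x. u x \<noteq> \<zero>\<^bsub>R\<^esub>} \<subseteq> B" "B \<subseteq> A"
  shows "lin_ext R M f u = (\<Oplus>\<^bsub>M\<^esub>x\<in>B. u x \<odot>\<^bsub>M\<^esub> f x)"
  unfolding lin_ext_def using assms
  by (intro M.add.finprod_mono_neutral_cong_left) (auto simp: carrier_free_module Pi_def subset_iff)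

lemma lin_ext_hom:
  assumes f: "f \<in> A \<rightarrow> carrier M"
  shows "lin_ext R M f \<in> module_hom R (free_module R A) M"
proof (rule module_homI)
  interpret F: module R "free_module R A" by (rule module_free_module[OF R.is_cring])
  fix u assume u: "u \<in> carrier (free_module R A)"
  let ?su = "{x. u x \<noteq> \<zero>\<^bsub>R\<^esub>}"
  show "lin_ext R M f u \<in> carrier M"
    unfolding lin_ext_def using u f
    by (intro M.finsum_closed) (auto simp: carrier_free_module Pi_def subset_iff)
  show "lin_ext R M f (c \<odot>\<^bsub>free_module R A\<^esub> u) = c \<odot>\<^bsub>M\<^esub> lin_ext R M f u"
    if c: "c \<in> carrier R" for c
  proof -
    \<comment> \<open>Scaling may shrink the support, so the sum is taken over that of
      \<open>u\<close>.\<close>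
    have "lin_ext R M f (c \<odot>\<^bsub>free_module R A\<^esub> u)
        = (\<Oplus>\<^bsub>M\<^esub>x\<in>?su. (c \<odot>\<^bsub>free_module R A\<^esub> u) x \<odot>\<^bsub>M\<^esub> f x)"
    proof (rule lin_ext_superset)
      show "c \<odot>\<^bsub>free_module R A\<^esub> u \<in> carrier (free_module R A)" using u c by simp
    qed (use u c f in \<open>auto simp: carrier_free_module free_module_simps\<close>)
    also have "\<dots> = (\<Oplus>\<^bsub>M\<^esub>x\<in>?su. c \<odot>\<^bsub>M\<^esub> (u x \<odot>\<^bsub>M\<^esub> f x))"
      using u c f
      by (intro M.finsum_cong')
        (auto simp: carrier_free_module free_module_simps smult_assoc1 Pi_def subset_iff)
    also have "\<dots> = c \<odot>\<^bsub>M\<^esub> lin_ext R M f u"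
      unfolding lin_ext_def using u c f
      by (intro finsum_smult_ldistr[symmetric]) (auto simp: carrier_free_module Pi_def subset_iff)
    finally show ?thesis .
  qed
  fix v assume v: "v \<in> carrier (free_module R A)"
  \<comment> \<open>The union of the two supports also contains the support of the sum, which
    cancellation may make smaller.\<close>
  let ?B = "?su \<union> {x. v x \<noteq> \<zero>\<^bsub>R\<^esub>}"
  have B: "finite ?B" "?B \<subseteq> A" using u v by (auto simp: carrier_free_module)
  have "lin_ext R M f (u \<oplus>\<^bsub>free_module R A\<^esub> v)
      = (\<Oplus>\<^bsub>M\<^esub>x\<in>?B. (u \<oplus>\<^bsub>free_module R A\<^esub> v) x \<odot>\<^bsub>M\<^esub> f x)"
  proof (rule lin_ext_superset)
    show "u \<oplus>\<^bsub>free_module R A\<^esub> v \<in> carrier (free_module R A)" using u v by simp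
  qed (use f B in \<open>auto simp: free_module_simps\<close>)
  also have "\<dots> = (\<Oplus>\<^bsub>M\<^esub>x\<in>?B. u x \<odot>\<^bsub>M\<^esub> f x \<oplus>\<^bsub>M\<^esub> v x \<odot>\<^bsub>M\<^esub> f x)"
    using u v f B
    by (intro M.finsum_cong')
      (auto simp: carrier_free_module free_module_simps smult_l_distr Pi_def subset_iff)
  also have "\<dots> = (\<Oplus>\<^bsub>M\<^esub>x\<in>?B. u x \<odot>\<^bsub>M\<^esub> f x) \<oplus>\<^bsub>M\<^esub> (\<Oplus>\<^bsub>M\<^esub>x\<in>?B. v x \<odot>\<^bsub>M\<^esub> f x)"
    using u v f B by (intro M.finsum_addf) (auto simp: carrier_free_module Pi_def subset_iff)
  also have "\<dots> = lin_ext R M f u \<oplus>\<^bsub>M\<^esub> lin_ext R M f v"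
    using u v f B by (subst (1 2) lin_ext_superset[where A = A and B = ?B]) auto
  finally show "lin_ext R M f (u \<oplus>\<^bsub>free_module R A\<^esub> v) = lin_ext R M f u \<oplus>\<^bsub>M\<^esub> lin_ext R M f v" .
qed

lemma lin_ext_free_gen:
  assumes f: "f \<in> A \<rightarrow> carrier M" and x: "x \<in> A"
  shows "lin_ext R M f (free_gen R x) = f x"
proof -
  \<comment> \<open>The index set is \<open>{x}\<close> and not the support, which is empty over the
    zero ring.\<close>
  have "lin_ext R M f (free_gen R x) = (\<Oplus>\<^bsub>M\<^esub>y\<in>{x}. free_gen R x y \<odot>\<^bsub>M\<^esub> f y)"
    using f x free_gen_closed[OF R.is_cring x]
    by (intro lin_ext_superset[where A = A]) (auto simp: free_gen_def)
  then show ?thesis using f x by (auto simp: free_gen_def Pi_def)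
qed

end

lemma finsum_free_module_apply:
  assumes "cring R" "finite B" "f \<in> B \<rightarrow> carrier (free_module R A)"
  shows "(\<Oplus>\<^bsub>free_module R A\<^esub>x\<in>B. f x) y = (\<Oplus>\<^bsub>R\<^esub>x\<in>B. f x y)"
proof -
  interpret cring R by fact
  interpret F: module R "free_module R A" by (rule module_free_module) fact
  show ?thesis using assms(2,3)
  proof (induct B rule: finite_induct)
    case empty
    show ?case by (simp add: free_module_simps)
  next
    case (insert b B)
    then have "f \<in> B \<rightarrow> carrier (free_module R A)" "f b \<in> carrier (free_module R A)"
      "(\<lambda>x. f x y) \<in> B \<rightarrow> carrier R" "f b y \<in> carrier R"
      by (auto simp: carrier_free_module Pi_def)
    with insert show ?case by (simp add: F.finsum_insert finsum_insert free_module_simps(2))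
  qed
qed

text \<open>Evaluation at \<open>y\<close> leaves only the term \<open>x = y\<close>, since
  \<open>free_gen R x y\<close> is zero for all other \<open>x\<close>.\<close>

lemma free_module_eq_finsum:
  assumes "cring R" "u \<in> carrier (free_module R A)"
  shows "u = (\<Oplus>\<^bsub>free_module R A\<^esub>x\<in>{x. u x \<noteq> \<zero>\<^bsub>R\<^esub>}. u x \<odot>\<^bsub>free_module R A\<^esub> free_gen R x)"
proof
  interpret cring R by fact
  interpret F: module R "free_module R A" by (rule module_free_module) fact
  fix y
  let ?B = "{x. u x \<noteq> \<zero>\<^bsub>R\<^esub>}"
  have u: "u x \<in> carrier R" "finite ?B" "?B \<subseteq> A" for x
    using assms(2) by (auto simp: carrier_free_module)
  have scaled: "u x \<odot>\<^bsub>free_module R A\<^esub> free_gen R x \<in> carrier (free_module R A)" if "x \<in> ?B" for x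
    using u that by (intro F.smult_closed free_gen_closed[OF assms(1)]) auto
  have "(\<Oplus>\<^bsub>free_module R A\<^esub>x\<in>?B. u x \<odot>\<^bsub>free_module R A\<^esub> free_gen R x) y
      = (\<Oplus>\<^bsub>R\<^esub>x\<in>?B. u x \<otimes>\<^bsub>R\<^esub> free_gen R x y)"
    using u(2) scaled
    by (subst finsum_free_module_apply[OF assms(1)]) (auto simp: free_module_simps(3) Pi_def)
  also have "\<dots> = (\<Oplus>\<^bsub>R\<^esub>x\<in>?B. if y = x then u x else \<zero>\<^bsub>R\<^esub>)"
    using u by (intro finsum_cong') (auto simp: free_gen_def)
  also have "\<dots> = u y"
  proof (cases "u y = \<zero>\<^bsub>R\<^esub>")
    case True
    then have "(\<Oplus>\<^bsub>R\<^esub>x\<in>?B. if y = x then u x else \<zero>\<^bsub>R\<^esub>) = (\<Oplus>\<^bsub>R\<^esub>x\<in>?B. \<zero>\<^bsub>R\<^esub>)"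
      by (intro finsum_cong') auto
    with True show ?thesis by (simp add: finsum_zero)
  next
    case False
    then show ?thesis using u by (intro finsum_singleton) auto
  qed
  finally show "u y = (\<Oplus>\<^bsub>free_module R A\<^esub>x\<in>?B. u x \<odot>\<^bsub>free_module R A\<^esub> free_gen R x) y" ..
qed

text \<open>A linear map is determined by its values on the free generators: apply \<open>h\<close>
  to the expansion of \<open>u\<close> in them. That \<open>f\<close> maps the support into
  \<open>N\<close> follows from its agreement with \<open>h\<close>.\<close>

lemma lin_ext_unique:
  assumes "module R N" "h \<in> module_hom R (free_module R A) N" "u \<in> carrier (free_module R A)"
    and "\<And>x. x \<in> A \<Longrightarrow> h (free_gen R x) = f x"
  shows "lin_ext R N f u = h u"
proof -
  interpret N: module R N by fact
  interpret F: module R "free_module R A" by (rule module_free_module) (rule N.R.is_cring)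
  let ?B = "{x. u x \<noteq> \<zero>\<^bsub>R\<^esub>}"
  have u: "u x \<in> carrier R" "finite ?B" "?B \<subseteq> A" for x
    using assms(3) by (auto simp: carrier_free_module)
  note gen = free_gen_closed[OF N.R.is_cring]
  have "h u = h (\<Oplus>\<^bsub>free_module R A\<^esub>x\<in>?B. u x \<odot>\<^bsub>free_module R A\<^esub> free_gen R x)"
    using free_module_eq_finsum[OF N.R.is_cring assms(3)] by simp
  also have "\<dots> = (\<Oplus>\<^bsub>N\<^esub>x\<in>?B. h (u x \<odot>\<^bsub>free_module R A\<^esub> free_gen R x))"
  proof (rule module_hom_finsum[OF F.module_axioms assms(1,2)])
    show "(\<lambda>x. u x \<odot>\<^bsub>free_module R A\<^esub> free_gen R x) \<in> ?B \<rightarrow> carrier (free_module R A)"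
      using u by (intro funcsetI F.smult_closed gen) auto
  qed (rule u)
  also have "\<dots> = lin_ext R N f u"
    unfolding lin_ext_def
  proof (rule N.finsum_cong')
    have *: "u x \<in> carrier R" "free_gen R x \<in> carrier (free_module R A)"
      "h (free_gen R x) = f x" "f x \<in> carrier N" if "x \<in> ?B" for x
    proof -
      have x: "x \<in> A" using u that by auto
      show "u x \<in> carrier R" by (rule u)
      show gx: "free_gen R x \<in> carrier (free_module R A)" using gen x .
      show "h (free_gen R x) = f x" using assms(4) x .
      with module_hom_closed[OF assms(2) gx] show "f x \<in> carrier N" by simp
    qed
    show "h (u x \<odot>\<^bsub>free_module R A\<^esub> free_gen R x) = u x \<odot>\<^bsub>N\<^esub> f x" if "x \<in> ?B" for x
      using module_hom_smult[OF assms(2) *(1,2)[OF that]] *(3)[OF that] by simp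
    show "(\<lambda>x. u x \<odot>\<^bsub>N\<^esub> f x) \<in> ?B \<rightarrow> carrier N"
      using * by (intro funcsetI N.smult_closed)
  qed simp
  finally show ?thesis ..
qed

section \<open>Tensor products and exterior powers\<close>

text \<open>Replaces the recursive definition of \<open>listset\<close> by a condition on each
  position, the form suited to list updates.\<close>

lemma mem_listset_iff:
  "xs \<in> listset As \<longleftrightarrow> length xs = length As \<and> (\<forall>i<length As. xs ! i \<in> As ! i)"
proof (induct As arbitrary: xs)
  case (Cons A As)
  show ?case
    by (cases xs) (auto simp: set_Cons_def Cons nth_Cons' less_Suc_eq_0_disj)
qed auto

lemma listset_update: "\<lbrakk>xs \<in> listset As; i < length As \<Longrightarrow> x \<in> As ! i\<rbrakk> \<Longrightarrow> xs[i := x] \<in> listset As"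
  by (cases "i < length As") (auto simp: mem_listset_iff nth_list_update)

lemma not_distinct_list_update:
  "\<lbrakk>i < length xs; j < length xs; i \<noteq> j\<rbrakk> \<Longrightarrow> \<not> distinct (xs[i := x, j := x])"
  by (metis distinct_conv_nth length_list_update nth_list_update_eq nth_list_update_neq)

section \<open>Tensor products and their universal property\<close>

context
  fixes R :: "('a, 'r) ring_scheme" and Ms :: "('a, 'b, 'm) module_scheme list"
  assumes cring: "cring R" and modules: "\<And>M. M \<in> set Ms \<Longrightarrow> module R M"
begin

interpretation T: module R "tensor_gens R Ms"
  unfolding tensor_gens_def by (rule module_free_module[OF cring])

lemma tensor_gen_closed:
  "xs \<in> listset (map carrier Ms) \<Longrightarrow> free_gen R xs \<in> carrier (tensor_gens R Ms)"
  unfolding tensor_gens_def by (rule free_gen_closed[OF cring])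

lemma tensor_rels_subset: "tensor_rels R Ms \<subseteq> carrier (tensor_gens R Ms)"
proof -
  have [simp]: "module R (Ms ! i)" if "i < length Ms" for i
    using modules that by simp
  have [simp]: "x \<oplus>\<^bsub>Ms ! i\<^esub> y \<in> carrier (Ms ! i)"
    if "i < length Ms" "x \<in> carrier (Ms ! i)" "y \<in> carrier (Ms ! i)" for i x y
    using abelian_monoid.a_closed[of "Ms ! i"] module.axioms(2)[of R "Ms ! i"] that
    by (simp add: abelian_group_def)
  have [simp]: "c \<odot>\<^bsub>Ms ! i\<^esub> x \<in> carrier (Ms ! i)"
    if "i < length Ms" "c \<in> carrier R" "x \<in> carrier (Ms ! i)" for i c x
    using module.smult_closed[of R "Ms ! i"] that by simp
  show ?thesis
    unfolding tensor_rels_def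
    by (auto intro!: T.M.minus_closed T.M.a_closed T.smult_closed tensor_gen_closed listset_update)
qed

lemma module_tensor: "module R (tensor R Ms)"
  unfolding tensor_def by (rule T.module_quot_module[OF tensor_rels_subset])

lemma pure_tensor_closed:
  "xs \<in> listset (map carrier Ms) \<Longrightarrow> pure_tensor R Ms xs \<in> carrier (tensor R Ms)"
  unfolding pure_tensor_def tensor_def
  by (rule module_hom_closed[OF T.quot_proj_hom[OF tensor_rels_subset] tensor_gen_closed])

text \<open>The difference of the two sides, lifted to the free module, is one of the additive
  relations in \<open>tensor_rels\<close>.\<close>

lemma pure_tensor_add:
  assumes "xs \<in> listset (map carrier Ms)" "i < length Ms"
    and "x \<in> carrier (Ms ! i)" "y \<in> carrier (Ms ! i)"
  shows "pure_tensor R Ms (xs[i := x \<oplus>\<^bsub>Ms ! i\<^esub> y])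
    = pure_tensor R Ms (xs[i := x]) \<oplus>\<^bsub>tensor R Ms\<^esub> pure_tensor R Ms (xs[i := y])"
proof -
  interpret M: module R "Ms ! i" using modules assms(2) by simp
  have gens: "free_gen R (xs[i := x \<oplus>\<^bsub>Ms ! i\<^esub> y]) \<in> carrier (tensor_gens R Ms)"
    "free_gen R (xs[i := x]) \<in> carrier (tensor_gens R Ms)"
    "free_gen R (xs[i := y]) \<in> carrier (tensor_gens R Ms)"
    using assms by (auto intro!: tensor_gen_closed listset_update)
  show ?thesis
    unfolding pure_tensor_def tensor_def T.quot_proj_add[OF tensor_rels_subset gens(2,3)]
    using assms
    by (intro T.quot_proj_eq_if_minus_gen[OF tensor_rels_subset] gens T.M.a_closed)
      (auto simp: tensor_rels_def)
qed

lemma pure_tensor_smult: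
  assumes "xs \<in> listset (map carrier Ms)" "i < length Ms" "c \<in> carrier R" "x \<in> carrier (Ms ! i)"
  shows "pure_tensor R Ms (xs[i := c \<odot>\<^bsub>Ms ! i\<^esub> x])
    = c \<odot>\<^bsub>tensor R Ms\<^esub> pure_tensor R Ms (xs[i := x])"
proof -
  interpret M: module R "Ms ! i" using modules assms(2) by simp
  have gens: "free_gen R (xs[i := c \<odot>\<^bsub>Ms ! i\<^esub> x]) \<in> carrier (tensor_gens R Ms)"
    "free_gen R (xs[i := x]) \<in> carrier (tensor_gens R Ms)"
    using assms by (auto intro!: tensor_gen_closed listset_update)
  show ?thesis
    unfolding pure_tensor_def tensor_def T.quot_proj_smult[OF tensor_rels_subset assms(3) gens(2)]
    using assms
    by (intro T.quot_proj_eq_if_minus_gen[OF tensor_rels_subset] gens T.smult_closed)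
      (auto simp: tensor_rels_def)
qed

text \<open>The universal property of the tensor product: a multilinear \<open>f\<close> is extended
  linearly to the free module on tuples, and multilinearity makes this extension kill both kinds of
  relations.\<close>

lemma tensor_lift_hom:
  assumes N: "module R N" and f: "f \<in> listset (map carrier Ms) \<rightarrow> carrier N"
    and add: "\<And>xs i x y. \<lbrakk>xs \<in> listset (map carrier Ms); i < length Ms;
        x \<in> carrier (Ms ! i); y \<in> carrier (Ms ! i)\<rbrakk>
      \<Longrightarrow> f (xs[i := x \<oplus>\<^bsub>Ms ! i\<^esub> y]) = f (xs[i := x]) \<oplus>\<^bsub>N\<^esub> f (xs[i := y])"
    and smult: "\<And>xs i c x. \<lbrakk>xs \<in> listset (map carrier Ms); i < length Ms;
        c \<in> carrier R; x \<in> carrier (Ms ! i)\<rbrakk>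
      \<Longrightarrow> f (xs[i := c \<odot>\<^bsub>Ms ! i\<^esub> x]) = c \<odot>\<^bsub>N\<^esub> f (xs[i := x])"
  shows "induced (lin_ext R N f) \<in> module_hom R (tensor R Ms) N"
  unfolding tensor_def
proof (rule T.induced_hom[OF tensor_rels_subset N])
  interpret N: module R N by fact
  show hom: "lin_ext R N f \<in> module_hom R (tensor_gens R Ms) N"
    unfolding tensor_gens_def using f by (rule N.lin_ext_hom)
  interpret h: abelian_group_hom "tensor_gens R Ms" N "lin_ext R N f"
    by (rule abelian_group_hom_module_hom[OF T.module_axioms N hom])
  note gen = N.lin_ext_free_gen[OF f]
  fix u assume "u \<in> tensor_rels R Ms"
  then consider
      (add) xs i x y where "u = free_gen R (xs[i := x \<oplus>\<^bsub>Ms ! i\<^esub> y])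
          \<ominus>\<^bsub>tensor_gens R Ms\<^esub> (free_gen R (xs[i := x]) \<oplus>\<^bsub>tensor_gens R Ms\<^esub> free_gen R (xs[i := y]))"
        "xs \<in> listset (map carrier Ms)" "i < length Ms" "x \<in> carrier (Ms ! i)" "y \<in> carrier (Ms ! i)"
    | (smult) xs i c x where "u = free_gen R (xs[i := c \<odot>\<^bsub>Ms ! i\<^esub> x])
          \<ominus>\<^bsub>tensor_gens R Ms\<^esub> (c \<odot>\<^bsub>tensor_gens R Ms\<^esub> free_gen R (xs[i := x]))"
        "xs \<in> listset (map carrier Ms)" "i < length Ms" "c \<in> carrier R" "x \<in> carrier (Ms ! i)"
    unfolding tensor_rels_def by blast
  then show "lin_ext R N f u = \<zero>\<^bsub>N\<^esub>"
  proof cases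
    case add': add
    interpret M: module R "Ms ! i" using modules add'(3) by simp
    have mem: "xs[i := x \<oplus>\<^bsub>Ms ! i\<^esub> y] \<in> listset (map carrier Ms)"
      "xs[i := x] \<in> listset (map carrier Ms)" "xs[i := y] \<in> listset (map carrier Ms)"
      using add' by (auto intro!: listset_update)
    have "f (xs[i := x]) \<in> carrier N" "f (xs[i := y]) \<in> carrier N"
      using mem f by auto
    then show ?thesis
      using add[OF add'(2-)] mem
      by (simp add: add'(1) gen tensor_gen_closed T.M.minus_eq N.M.r_neg)
  next
    case smult': smult
    interpret M: module R "Ms ! i" using modules smult'(3) by simp
    have mem: "xs[i := c \<odot>\<^bsub>Ms ! i\<^esub> x] \<in> listset (map carrier Ms)"
      "xs[i := x] \<in> listset (map carrier Ms)"
      using smult' by (auto intro!: listset_update)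
    have "f (xs[i := x]) \<in> carrier N"
      using mem f by auto
    then show ?thesis
      using smult[OF smult'(2-)] mem smult'(4)
      by (simp add: smult'(1) gen tensor_gen_closed T.M.minus_eq N.M.r_neg module_hom_smult[OF hom])
  qed
qed

text \<open>On a generator \<open>xs\<close> the linear extension behind \<open>tensor_map\<close>
  gives the pure tensor of \<open>xs\<close>, as the quotient projection does. By uniqueness they
  agree on all representatives, and the projection induces the identity.\<close>

lemma tensor_map_identity:
  assumes "length fs = length Ms"
    and "\<And>i x. \<lbrakk>i < length Ms; x \<in> carrier (Ms ! i)\<rbrakk> \<Longrightarrow> (fs ! i) x = x"
    and Y: "Y \<in> carrier (tensor R Ms)"
  shows "tensor_map R Ms fs Y = Y"
proof -
  interpret N: module R "tensor R Ms" by (rule module_tensor)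
  have id: "map2 (\<lambda>f x. f x) fs xs = xs" if "xs \<in> listset (map carrier Ms)" for xs
    using that assms(1,2) by (auto simp: mem_listset_iff intro!: nth_equalityI)
  have sub: "u \<in> carrier (tensor_gens R Ms)" if "u \<in> Y" for u
    using T.quot_module_subset_carrier[OF tensor_rels_subset] Y that
    unfolding tensor_def by blast
  have "lin_ext R (tensor R Ms) (\<lambda>xs. pure_tensor R Ms (map2 (\<lambda>f x. f x) fs xs)) u
      = quot_proj R (tensor_gens R Ms) (tensor_rels R Ms) u" if "u \<in> Y" for u
  proof (rule lin_ext_unique[where A = "listset (map carrier Ms)"])
    show "quot_proj R (tensor_gens R Ms) (tensor_rels R Ms)
        \<in> module_hom R (free_module R (listset (map carrier Ms))) (tensor R Ms)"
      using T.quot_proj_hom[OF tensor_rels_subset] unfolding tensor_def tensor_gens_def .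
    show "u \<in> carrier (free_module R (listset (map carrier Ms)))"
      using sub[OF that] unfolding tensor_gens_def .
  qed (auto simp: id pure_tensor_def N.module_axioms)
  then have "tensor_map R Ms fs Y = induced (quot_proj R (tensor_gens R Ms) (tensor_rels R Ms)) Y"
    unfolding tensor_map_def lin_ext_def by (intro induced_cong)
  also have "\<dots> = Y"
    using T.induced_quot_proj_self[OF tensor_rels_subset] Y unfolding tensor_def .
  finally show ?thesis .
qed

end

text \<open>Applying linear maps entry by entry and then forming the pure tensor is multilinear, so
  \<open>tensor_lift_hom\<close> applies.\<close>

lemma tensor_map_hom:
  assumes "cring R" "\<And>M. M \<in> set Ms \<Longrightarrow> module R M" "\<And>N. N \<in> set Ns \<Longrightarrow> module R N"
    and len: "length Ns = length Ms" "length fs = length Ms"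
    and fs: "\<And>i. i < length Ms \<Longrightarrow> fs ! i \<in> module_hom R (Ms ! i) (Ns ! i)"
  shows "tensor_map R Ns fs \<in> module_hom R (tensor R Ms) (tensor R Ns)"
proof -
  have mem: "map2 (\<lambda>f x. f x) fs xs \<in> listset (map carrier Ns)" if "xs \<in> listset (map carrier Ms)" for xs
    using that len module_hom_closed[OF fs] by (auto simp: mem_listset_iff)
  \<comment> \<open>Changing one entry before applying the maps changes one entry afterwards; this
    reduces the claim to the multilinearity of pure tensors.\<close>
  have upd: "map2 (\<lambda>f x. f x) fs (xs[i := x]) = (map2 (\<lambda>f x. f x) fs xs)[i := (fs ! i) x]"
    if "xs \<in> listset (map carrier Ms)" "i < length Ms" for xs i x
    using that len by (auto simp: mem_listset_iff nth_list_update intro!: nth_equalityI)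
  have mems: "i < length Ms \<Longrightarrow> x \<in> carrier (Ms ! i) \<Longrightarrow> (fs ! i) x \<in> carrier (Ns ! i)" for i x
    using module_hom_closed[OF fs] .
  have "tensor_map R Ns fs =
      induced (lin_ext R (tensor R Ns) (\<lambda>xs. pure_tensor R Ns (map2 (\<lambda>f x. f x) fs xs)))"
    unfolding tensor_map_def lin_ext_def ..
  also have "\<dots> \<in> module_hom R (tensor R Ms) (tensor R Ns)"
  proof (rule tensor_lift_hom[OF assms(1,2) module_tensor[OF assms(1,3)]])
    show "(\<lambda>xs. pure_tensor R Ns (map2 (\<lambda>f x. f x) fs xs))
        \<in> listset (map carrier Ms) \<rightarrow> carrier (tensor R Ns)"
      using mem pure_tensor_closed[OF assms(1,3)] by blast
    fix xs i x assume xs: "xs \<in> listset (map carrier Ms)" "i < length Ms" and x: "x \<in> carrier (Ms ! i)"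
    show "pure_tensor R Ns (map2 (\<lambda>f x. f x) fs (xs[i := x \<oplus>\<^bsub>Ms ! i\<^esub> y])) =
        pure_tensor R Ns (map2 (\<lambda>f x. f x) fs (xs[i := x])) \<oplus>\<^bsub>tensor R Ns\<^esub>
        pure_tensor R Ns (map2 (\<lambda>f x. f x) fs (xs[i := y]))" if y: "y \<in> carrier (Ms ! i)" for y
      unfolding upd[OF xs] module_hom_add[OF fs[OF xs(2)] x y] using xs x y len
      by (intro pure_tensor_add[OF assms(1,3)] mem mems) auto
    show "pure_tensor R Ns (map2 (\<lambda>f x. f x) fs (xs[i := c \<odot>\<^bsub>Ms ! i\<^esub> x])) =
        c \<odot>\<^bsub>tensor R Ns\<^esub> pure_tensor R Ns (map2 (\<lambda>f x. f x) fs (xs[i := x]))"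
      if c: "c \<in> carrier R" for c
      unfolding upd[OF xs] module_hom_smult[OF fs[OF xs(2)] c x] using xs x c len
      by (intro pure_tensor_smult[OF assms(1,3)] mem mems) auto
  qed assumption
  finally show ?thesis .
qed

section \<open>Exterior powers and the alternating property of wedges\<close>

context module
begin

lemma mem_listset_replicate:
  "xs \<in> listset (map carrier (replicate r M)) \<longleftrightarrow> length xs = r \<and> set xs \<subseteq> carrier M"
  by (auto simp: mem_listset_iff set_conv_nth simp del: map_replicate)

lemma module_tensor_power: "module R (tensor R (replicate r M))"
  by (rule module_tensor[OF R.is_cring]) (simp add: module_axioms)

lemma ext_rels_subset: "ext_rels R M r \<subseteq> carrier (tensor R (replicate r M))"
  unfolding ext_rels_def
  by (auto intro!: pure_tensor_closed[OF R.is_cring]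
      simp: module_axioms mem_listset_replicate simp del: map_replicate)

lemma module_ext_power: "module R (ext_power R M r)"
  unfolding ext_power_def by (rule module.module_quot_module[OF module_tensor_power ext_rels_subset])

lemma ext_proj_hom:
  "quot_proj R (tensor R (replicate r M)) (ext_rels R M r)
    \<in> module_hom R (tensor R (replicate r M)) (ext_power R M r)"
  unfolding ext_power_def by (rule module.quot_proj_hom[OF module_tensor_power ext_rels_subset])

lemma pure_tensor_power_closed:
  "\<lbrakk>length xs = r; set xs \<subseteq> carrier M\<rbrakk>
    \<Longrightarrow> pure_tensor R (replicate r M) xs \<in> carrier (tensor R (replicate r M))"
  by (rule pure_tensor_closed[OF R.is_cring])
    (simp_all add: module_axioms mem_listset_replicate del: map_replicate)

lemma wedge_closed:
  "\<lbrakk>length xs = r; set xs \<subseteq> carrier M\<rbrakk> \<Longrightarrow> wedge R M xs \<in> carrier (ext_power R M r)"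
  using module_hom_closed[OF ext_proj_hom pure_tensor_power_closed[of xs r]]
  by (simp add: wedge_def)

lemma wedge_add:
  assumes "length xs = r" "set xs \<subseteq> carrier M" "i < r" "x \<in> carrier M" "y \<in> carrier M"
  shows "wedge R M (xs[i := x \<oplus>\<^bsub>M\<^esub> y])
    = wedge R M (xs[i := x]) \<oplus>\<^bsub>ext_power R M r\<^esub> wedge R M (xs[i := y])"
proof -
  have "pure_tensor R (replicate r M) (xs[i := x \<oplus>\<^bsub>replicate r M ! i\<^esub> y])
      = pure_tensor R (replicate r M) (xs[i := x]) \<oplus>\<^bsub>tensor R (replicate r M)\<^esub>
        pure_tensor R (replicate r M) (xs[i := y])"
    using assms by (intro pure_tensor_add[OF R.is_cring])
      (simp_all add: module_axioms mem_listset_replicate del: map_replicate)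
  moreover have "set (xs[i := x]) \<subseteq> carrier M" "set (xs[i := y]) \<subseteq> carrier M"
    using assms set_update_subset_insert[of xs i] by blast+
  ultimately show ?thesis
    using assms by (simp add: wedge_def module_hom_add[OF ext_proj_hom] pure_tensor_power_closed)
qed

lemma wedge_smult:
  assumes "length xs = r" "set xs \<subseteq> carrier M" "i < r" "c \<in> carrier R" "x \<in> carrier M"
  shows "wedge R M (xs[i := c \<odot>\<^bsub>M\<^esub> x]) = c \<odot>\<^bsub>ext_power R M r\<^esub> wedge R M (xs[i := x])"
proof -
  have "pure_tensor R (replicate r M) (xs[i := c \<odot>\<^bsub>replicate r M ! i\<^esub> x])
      = c \<odot>\<^bsub>tensor R (replicate r M)\<^esub> pure_tensor R (replicate r M) (xs[i := x])"
    using assms by (intro pure_tensor_smult[OF R.is_cring])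
      (simp_all add: module_axioms mem_listset_replicate del: map_replicate)
  moreover have "set (xs[i := x]) \<subseteq> carrier M"
    using assms set_update_subset_insert[of xs i] by blast
  ultimately show ?thesis
    using assms by (simp add: wedge_def module_hom_smult[OF ext_proj_hom] pure_tensor_power_closed)
qed

lemma wedge_not_distinct:
  assumes "length xs = r" "set xs \<subseteq> carrier M" "\<not> distinct xs"
  shows "wedge R M xs = \<zero>\<^bsub>ext_power R M r\<^esub>"
  using module.quot_proj_gen[OF module_tensor_power ext_rels_subset, of _ r] assms
  unfolding wedge_def ext_power_def ext_rels_def by blast

text \<open>Alternating implies antisymmetric: put \<open>x + y\<close> in positions
  \<open>i\<close> and \<open>j\<close>, expand the vanishing wedge, and drop the two terms with a
  repeated factor.\<close>

lemma wedge_swap: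
  assumes xs: "length xs = r" "set xs \<subseteq> carrier M" and ij: "i < r" "j < r" "i \<noteq> j"
    and x: "x \<in> carrier M" and y: "y \<in> carrier M"
  shows "wedge R M (xs[i := x, j := y]) = \<ominus>\<^bsub>ext_power R M r\<^esub> wedge R M (xs[i := y, j := x])"
proof -
  interpret W: module R "ext_power R M r" by (rule module_ext_power)
  have len: "length (xs[i := a]) = r" for a using xs by simp
  have upd: "set (ys[k := a]) \<subseteq> carrier M" if "set ys \<subseteq> carrier M" "a \<in> carrier M" for ys k a
    using that set_update_subset_insert[of ys k a] by blast
  have cl: "wedge R M (xs[i := a, j := b]) \<in> carrier (ext_power R M r)"
    if "a \<in> carrier M" "b \<in> carrier M" for a b
    using xs that by (intro wedge_closed upd) auto
  have rep: "wedge R M (xs[i := a, j := a]) = \<zero>\<^bsub>ext_power R M r\<^esub>" if "a \<in> carrier M" for a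
    using xs that ij by (intro wedge_not_distinct upd not_distinct_list_update) auto
  \<comment> \<open>\<open>wedge_add\<close> expands the outermost update; exchanging the two
    updates makes it apply to position \<open>i\<close>.\<close>
  have first: "wedge R M (xs[i := x \<oplus>\<^bsub>M\<^esub> y, j := a])
      = wedge R M (xs[i := x, j := a]) \<oplus>\<^bsub>ext_power R M r\<^esub> wedge R M (xs[i := y, j := a])"
    if "a \<in> carrier M" for a
    using wedge_add[of "xs[j := a]" r i x y] xs that x y ij upd[OF xs(2) that]
    by (simp add: list_update_swap[of i j])
  have "\<zero>\<^bsub>ext_power R M r\<^esub> = wedge R M (xs[i := x \<oplus>\<^bsub>M\<^esub> y, j := x \<oplus>\<^bsub>M\<^esub> y])"
    using x y by (simp add: rep)
  also have "\<dots> = wedge R M (xs[i := x, j := y]) \<oplus>\<^bsub>ext_power R M r\<^esub> wedge R M (xs[i := y, j := x])"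
    using x y ij xs by (simp add: wedge_add[OF len upd] first rep cl)
      (simp add: W.M.a_comm cl)
  finally show ?thesis
    using W.M.minus_equality[of "wedge R M (xs[i := x, j := y])" "wedge R M (xs[i := y, j := x])"]
      cl x y by simp
qed

text \<open>A wedge of factors from \<open>L = \<langle>z\<rangle> + K\<close> is expanded by multilinearity: terms with two factors \<open>z\<close>
  vanish, and a single factor \<open>z\<close> can be moved to position \<open>p\<close>, so that all later factors are in \<open>K\<close>.
  The induction makes the factors at positions \<open>p + 1, p + 2, \<dots>\<close> members of \<open>K\<close>, one after the other.\<close>

lemma wedge_mem_submodule:
  assumes N: "submodule N R (ext_power R M r)"
    and z: "z \<in> carrier M" and K: "K \<subseteq> carrier M" and L: "K \<subseteq> L" "z \<in> L"
    and decomp: "\<And>x. x \<in> L \<Longrightarrow> \<exists>c\<in>carrier R. \<exists>y\<in>K. x = c \<odot>\<^bsub>M\<^esub> z \<oplus>\<^bsub>M\<^esub> y"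
    and rels: "\<And>xs. \<lbrakk>length xs = r; set xs \<subseteq> carrier M; \<forall>j\<in>{p+1..<r}. xs ! j \<in> K\<rbrakk> \<Longrightarrow> wedge R M xs \<in> N"
    and xs: "length xs = r" "set xs \<subseteq> carrier M" "\<forall>j\<in>{p..<r}. xs ! j \<in> L" and p: "p < r"
  shows "wedge R M xs \<in> N"
proof -
  interpret W: module R "ext_power R M r" by (rule module_ext_power)
  note sub = W.submoduleE[OF N]
  have upd: "set (ys[k := a]) \<subseteq> carrier M" if "set ys \<subseteq> carrier M" "a \<in> carrier M" for ys k a
    using that set_update_subset_insert[of ys k a] by blast
  \<comment> \<open>The statement is generalised by a bound \<open>q\<close> below which the factors
    after \<open>p\<close> already lie in \<open>K\<close>. The induction descends from
    \<open>q = r\<close>, where \<open>rels\<close> applies, to \<open>q = p + 1\<close>, where the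
    condition is empty.\<close>
  have "wedge R M xs \<in> N"
    if "q \<le> r" "p + 1 \<le> q" "length xs = r" "set xs \<subseteq> carrier M"
      "\<forall>j\<in>{p..<r}. xs ! j \<in> L" "\<forall>j\<in>{p+1..<q}. xs ! j \<in> K" for q xs
    using that
  proof (induct q arbitrary: xs rule: inc_induct)
    case base
    then show ?case by (intro rels)
  next
    case (step q)
    note q = \<open>q < r\<close> \<open>p + 1 \<le> q\<close> and xs = \<open>length xs = r\<close> \<open>set xs \<subseteq> carrier M\<close>
    have IH: "wedge R M ys \<in> N"
      if "length ys = r" "set ys \<subseteq> carrier M" "\<forall>j\<in>{p..<r}. ys ! j \<in> L" "\<forall>j\<in>{p+1..<q}. ys ! j \<in> K"
        "ys ! q \<in> K" for ys
      using that q by (intro step(3)) (auto simp: less_Suc_eq)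
    obtain c y where c: "c \<in> carrier R" "y \<in> K" "xs ! q = c \<odot>\<^bsub>M\<^esub> z \<oplus>\<^bsub>M\<^esub> y"
      using decomp[of "xs ! q"] step.prems q by auto
    obtain d y' where d: "d \<in> carrier R" "y' \<in> K" "xs ! p = d \<odot>\<^bsub>M\<^esub> z \<oplus>\<^bsub>M\<^esub> y'"
      using decomp[of "xs ! p"] step.prems p by auto
    have y: "y \<in> carrier M" "y' \<in> carrier M" using c d K by auto
    \<comment> \<open>By linearity at \<open>q\<close>, the wedge splits into one with
      \<open>z\<close> there, treated first, and one with \<open>y \<in> K\<close>, covered by the
      induction hypothesis.\<close>
    let ?xz = "xs[q := z]"
    have xz: "length ?xz = r" "set ?xz \<subseteq> carrier M" "?xz[p := xs ! p] = ?xz"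
      using xs upd z q by (auto simp: list_update_swap[of q p])
    \<comment> \<open>By linearity at \<open>p\<close>, the wedge of \<open>?xz\<close> splits
      again. With \<open>z\<close> at both positions it vanishes.\<close>
    have "wedge R M (?xz[p := z]) = \<zero>\<^bsub>ext_power R M r\<^esub>"
      using xs upd z q p by (intro wedge_not_distinct upd not_distinct_list_update) auto
    moreover have "wedge R M (?xz[p := y']) \<in> N"
    proof -
      \<comment> \<open>Exchanging positions \<open>p\<close> and \<open>q\<close> moves
        \<open>z\<close> to \<open>p\<close> and puts \<open>y' \<in> K\<close> at \<open>q\<close>,
        so the induction hypothesis applies; the sign is absorbed by \<open>N\<close>.\<close>
      have "wedge R M (xs[q := y', p := z]) \<in> N"
        using xs upd z y d(2) L q p step.prems by (intro IH) (auto simp: nth_list_update)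
      then show ?thesis
        using wedge_swap[OF xs, of q p z y'] z y q p sub(3) by simp
    qed
    moreover have "wedge R M (?xz[p := d \<odot>\<^bsub>M\<^esub> z \<oplus>\<^bsub>M\<^esub> y'])
        = d \<odot>\<^bsub>ext_power R M r\<^esub> wedge R M (?xz[p := z]) \<oplus>\<^bsub>ext_power R M r\<^esub> wedge R M (?xz[p := y'])"
      using xz z y d(1) p by (simp add: wedge_add wedge_smult)
    ultimately have "wedge R M ?xz \<in> N"
      using xz(3) d(1,3) sub(1) by (auto simp: subset_iff)
    moreover have "wedge R M (xs[q := y]) \<in> N"
      using xs upd y c(2) L q step.prems by (intro IH) (auto simp: nth_list_update)
    moreover have "wedge R M (xs[q := c \<odot>\<^bsub>M\<^esub> z \<oplus>\<^bsub>M\<^esub> y])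
        = c \<odot>\<^bsub>ext_power R M r\<^esub> wedge R M ?xz \<oplus>\<^bsub>ext_power R M r\<^esub> wedge R M (xs[q := y])"
      using xs z y c(1) q by (simp add: wedge_add wedge_smult)
    ultimately show ?case
      using sub(4,5) c by (metis list_update_id)
  qed
  from this[of "p + 1" xs] show ?thesis using xs p by auto
qed

end

text \<open>The elements \<open>c z + y\<close> form a submodule containing \<open>z\<close> and
  \<open>S\<close>, hence everything generated by them. This supplies the decomposition hypothesis
  of \<open>wedge_mem_submodule\<close>.\<close>

lemma (in module) submod_gen_insert:
  assumes S: "S \<subseteq> carrier M" and z: "z \<in> carrier M" and x: "x \<in> submod_gen R M (insert z S)"
  shows "\<exists>c\<in>carrier R. \<exists>y\<in>submod_gen R M S. x = c \<odot>\<^bsub>M\<^esub> z \<oplus>\<^bsub>M\<^esub> y"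
proof -
  let ?K = "submod_gen R M S"
  let ?H = "{c \<odot>\<^bsub>M\<^esub> z \<oplus>\<^bsub>M\<^esub> y | c y. c \<in> carrier R \<and> y \<in> ?K}"
  have K: "submodule ?K R M" by (rule submodule_submod_gen[OF S])
  note sub = submoduleE[OF K]
  have memI: "u \<in> ?H" if "u = c \<odot>\<^bsub>M\<^esub> z \<oplus>\<^bsub>M\<^esub> y" "c \<in> carrier R" "y \<in> ?K" for u c y
    using that by blast
  have "submodule ?H R M"
  proof (rule submoduleI)
    show "?H \<subseteq> carrier M" using sub(1) z by auto
    show "\<zero>\<^bsub>M\<^esub> \<in> ?H"
      by (rule memI[of _ "\<zero>" "\<zero>\<^bsub>M\<^esub>"]) (use z submodule_zero[OF K] in auto)
  next
    fix u assume "u \<in> ?H"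
    then obtain c y where u: "u = c \<odot>\<^bsub>M\<^esub> z \<oplus>\<^bsub>M\<^esub> y" "c \<in> carrier R" "y \<in> ?K" by blast
    then have y: "y \<in> carrier M" using sub(1) by blast
    show "\<ominus>\<^bsub>M\<^esub> u \<in> ?H"
      by (rule memI[of _ "\<ominus> c" "\<ominus>\<^bsub>M\<^esub> y"])
        (use u y z sub(3) in \<open>auto simp: smult_l_minus M.minus_add\<close>)
    show "d \<odot>\<^bsub>M\<^esub> u \<in> ?H" if "d \<in> carrier R" for d
      by (rule memI[of _ "d \<otimes> c" "d \<odot>\<^bsub>M\<^esub> y"])
        (use u y z that sub(4) in \<open>auto simp: smult_r_distr smult_assoc1\<close>)
    fix v assume "v \<in> ?H"
    then obtain d w where v: "v = d \<odot>\<^bsub>M\<^esub> z \<oplus>\<^bsub>M\<^esub> w" "d \<in> carrier R" "w \<in> ?K" by blast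
    then have w: "w \<in> carrier M" using sub(1) by blast
    show "u \<oplus>\<^bsub>M\<^esub> v \<in> ?H"
      by (rule memI[of _ "c \<oplus> d" "y \<oplus>\<^bsub>M\<^esub> w"])
        (use u v y w z sub(5) in \<open>auto simp: smult_l_distr M.a_ac\<close>)
  qed
  moreover have "insert z S \<subseteq> ?H"
  proof (intro insert_subsetI subsetI)
    show "z \<in> ?H"
      by (rule memI[of _ "\<one>" "\<zero>\<^bsub>M\<^esub>"]) (use z submodule_zero[OF K] in auto)
    show "s \<in> ?H" if "s \<in> S" for s
      by (rule memI[of _ "\<zero>" s]) (use z S that submod_gen_incl[of S] in auto)
  qed
  ultimately have "x \<in> ?H" using submod_gen_least x by blast
  then show ?thesis by blast
qed

section \<open>Columns containing both \<open>k\<close> and \<open>k + 1\<close>\<close>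

text \<open>A strictly increasing list of naturals has no room for an entry between \<open>k\<close>
  and \<open>k + 1\<close>, so they are neighbours.\<close>

lemma sorted_list_of_set_consecutive:
  fixes a :: "nat set"
  assumes "finite a" "k + 1 \<in> a" "i < card a" "sorted_list_of_set a ! i = k"
  shows "i + 1 < card a" "sorted_list_of_set a ! (i + 1) = k + 1"
proof -
  let ?l = "sorted_list_of_set a"
  have len: "length ?l = card a" by simp
  have less: "?l ! u < ?l ! v" if "u < v" "v < card a" for u v
    using sorted_wrt_nth_less[OF strict_sorted_list_of_set[of a]] that len by simp
  obtain j where j: "j < card a" "?l ! j = k + 1"
    using assms(1,2) len by (metis in_set_conv_nth set_sorted_list_of_set)
  have "i < j"
    using less[of j i] assms(3,4) j by (cases i j rule: linorder_cases) auto
  \<comment> \<open>Otherwise the entry at \<open>i + 1\<close> would lie strictly between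
    \<open>k\<close> and \<open>k + 1\<close>.\<close>
  moreover have "\<not> i + 1 < j"
    using less[of i "i + 1"] less[of "i + 1" j] assms(4) j by auto
  ultimately have "j = i + 1" by simp
  with j show "i + 1 < card a" "?l ! (i + 1) = k + 1" by auto
qed

section \<open>Column relations of the two flags\<close>

context module
begin

text \<open>\<open>BS_op k\<close> leaves the positions below \<open>k\<close> alone and shifts the
  others down by one; the kernel of the projection in position \<open>p\<close> is then spanned by
  the basis vectors beyond the shifted row.\<close>

lemma column_rels_standard:
  assumes z: "z \<in> {1..n} \<rightarrow> carrier M"
  shows "column_rels R M (BS_op k (standard_flag R M n z)) a =
    {wedge R M xs | xs i. length xs = card a \<and> set xs \<subseteq> carrier M \<and> i < card a \<and>
      (let p = sorted_list_of_set a ! i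
       in \<forall>j\<in>{i..<card a}. xs ! j \<in> submod_gen R M (z ` {if p < k then p else p - 1<..n}))}"
proof -
  let ?row = "\<lambda>p. if p < k then p else p - 1"
  have gens: "z ` {p<..n} \<subseteq> carrier M" for p using z by auto
  have "BS_op k (standard_flag R M n z) p
      = (quot_module R M (z ` {?row p<..n}), quot_proj R M (z ` {?row p<..n}))" for p
    by (simp add: BS_op_def standard_flag_def)
  then show ?thesis
    by (simp only: column_rels_def Let_def a_kernel_quot_proj[OF gens] prod.case)
qed

lemma column_rels_subset: "column_rels R M F a \<subseteq> carrier (ext_power R M (card a))"
  unfolding column_rels_def by (auto intro: wedge_closed)

text \<open>Only a row equal to \<open>k\<close> receives different kernels from the two flags; its
  additional relations are recovered from the row \<open>k + 1\<close> of the same column.\<close>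

lemma submod_gen_column_rels:
  assumes z: "z \<in> {1..n} \<rightarrow> carrier M" and k: "1 \<le> k" and a: "a \<subseteq> {1..n}"
    and full: "k \<in> a \<Longrightarrow> k + 1 \<in> a"
  shows "submod_gen R (ext_power R M (card a)) (column_rels R M (BS_op (k + 1) (standard_flag R M n z)) a)
    = submod_gen R (ext_power R M (card a)) (column_rels R M (BS_op k (standard_flag R M n z)) a)"
    (is "submod_gen R ?W ?A = submod_gen R ?W ?B")
proof (rule module.submod_gen_eqI[OF module_ext_power column_rels_subset column_rels_subset])
  interpret W: module R ?W by (rule module_ext_power)
  let ?K = "\<lambda>p. submod_gen R M (z ` {p<..n})"
  let ?s = "sorted_list_of_set a"
  have gens: "z ` {p<..n} \<subseteq> carrier M" for p using z by auto
  have fin: "finite a" using a finite_subset by blast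
  show "?A \<subseteq> submod_gen R ?W ?B"
  proof (rule subset_trans[OF _ W.submod_gen_incl])
    \<comment> \<open>The two indices differ only for \<open>p = k\<close>, where \<open>k\<close>
      on the left becomes \<open>k - 1\<close> on the right and the kernel grows.\<close>
    have "?K (if p < k + 1 then p else p - 1) \<subseteq> ?K (if p < k then p else p - 1)" for p
      by (intro submod_gen_mono) auto
    then show "?A \<subseteq> ?B"
      unfolding column_rels_standard[OF z] Let_def by blast
  qed
  show "?B \<subseteq> submod_gen R ?W ?A"
  proof
    fix w assume "w \<in> ?B"
    then obtain xs i where w: "w = wedge R M xs" and xs: "length xs = card a" "set xs \<subseteq> carrier M"
      and i: "i < card a"
      and ker: "\<forall>j\<in>{i..<card a}. xs ! j \<in> ?K (if ?s ! i < k then ?s ! i else ?s ! i - 1)"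
      unfolding column_rels_standard[OF z] Let_def by blast
    have rel: "wedge R M ys \<in> submod_gen R ?W ?A"
      if "length ys = card a" "set ys \<subseteq> carrier M" "j < card a"
        "\<forall>l\<in>{j..<card a}. ys ! l \<in> ?K (if ?s ! j < k + 1 then ?s ! j else ?s ! j - 1)" for ys j
    proof -
      have "wedge R M ys \<in> ?A"
        unfolding column_rels_standard[OF z] Let_def using that by blast
      then show ?thesis using W.submod_gen_incl by blast
    qed
    show "w \<in> submod_gen R ?W ?A"
    proof (cases "?s ! i = k")
      case False
      then have "(if ?s ! i < k + 1 then ?s ! i else ?s ! i - 1) = (if ?s ! i < k then ?s ! i else ?s ! i - 1)"
        by auto
      then show ?thesis unfolding w using rel[OF xs i] ker by simp
    next
      case True
      have ka: "k \<in> a" using True i fin by (metis nth_mem length_sorted_list_of_set set_sorted_list_of_set)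
      then have kn: "k \<in> {1..n}" using a by blast
      note next_row = sorted_list_of_set_consecutive[OF fin full[OF ka] i True]
      \<comment> \<open>The subtraction is truncated: \<open>1 \<le> k\<close> makes
        \<open>k - 1\<close> the true predecessor, and \<open>k \<le> n\<close> puts
        \<open>z k\<close> among the generators.\<close>
      have ins: "z ` {k - 1<..n} = insert (z k) (z ` {k<..n})"
      proof -
        have "{k - 1<..n} = insert k {k<..n}" using kn by auto
        then show ?thesis by simp
      qed
      show ?thesis
        unfolding w
      proof (rule wedge_mem_submodule[where p = i and z = "z k" and K = "?K k" and L = "?K (k - 1)"])
        show "submodule (submod_gen R ?W ?A) R ?W"
          by (rule W.submodule_submod_gen[OF column_rels_subset])
        show zk: "z k \<in> carrier M" using z kn by blast
        show "?K k \<subseteq> carrier M" by (rule submoduleE(1)[OF submodule_submod_gen[OF gens]])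
        show "?K k \<subseteq> ?K (k - 1)" by (intro submod_gen_mono) auto
        show "z k \<in> ?K (k - 1)" using submod_gen_incl[of "z ` {k - 1<..n}"] ins by blast
        show "\<exists>c\<in>carrier R. \<exists>y\<in>?K k. x = c \<odot>\<^bsub>M\<^esub> z k \<oplus>\<^bsub>M\<^esub> y" if "x \<in> ?K (k - 1)" for x
          using submod_gen_insert[OF gens zk] that unfolding ins .
        \<comment> \<open>Position \<open>i + 1\<close> holds row \<open>k + 1\<close>, which
          \<open>BS_op (k + 1)\<close> shifts to \<open>k\<close>, so its relations in
          \<open>?A\<close> use exactly \<open>?K k\<close>.\<close>
        show "wedge R M ys \<in> submod_gen R ?W ?A"
          if "length ys = card a" "set ys \<subseteq> carrier M" "\<forall>j\<in>{i+1..<card a}. ys ! j \<in> ?K k" for ys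
          using rel[OF that(1,2) next_row(1)] that(3) next_row(2) by simp
      qed (use xs i ker True in auto)
    qed
  qed
qed

end

section \<open>Flagged Schur modules\<close>

text \<open>The facts on quotients require the generators to lie in the module. Here this holds
  because each wedge in \<open>TE_basis\<close> has as many factors as its column has boxes, and
  \<open>TE_to_TF\<close> is linear.\<close>

lemma schur_exchange_subset:
  assumes R: "cring R" and E: "module R E" and z: "z \<in> {1..n} \<rightarrow> carrier E"
  shows "TE_to_TF R E F D ` exchange_rels R E n z D \<subseteq> carrier (TF R E F D)"
proof -
  interpret E: module R E by fact
  let ?W = "map (\<lambda>a. ext_power R E (card a)) D"
  have mods: "\<And>M. M \<in> set ?W \<Longrightarrow> module R M" using E.module_ext_power by auto
  interpret T: module R "TE R E D" unfolding TE_def by (rule module_tensor[OF R mods])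
  have col: "module R (column_module R E F a)"
    "column_proj R E F a \<in> module_hom R (ext_power R E (card a)) (column_module R E F a)" for a
    unfolding column_module_def column_proj_def
    using module.module_quot_module[OF E.module_ext_power E.column_rels_subset]
      module.quot_proj_hom[OF E.module_ext_power E.column_rels_subset] by auto
  have hom: "TE_to_TF R E F D \<in> module_hom R (TE R E D) (TF R E F D)"
    unfolding TE_to_TF_def TE_def TF_def
    using col mods by (intro tensor_map_hom[OF R]) auto
  have basis: "TE_basis R E z D \<tau> \<in> carrier (TE R E D)" if "\<tau> \<in> fillings n D" for \<tau>
    unfolding TE_basis_def TE_def
  proof (rule pure_tensor_closed[OF R mods])
    have "wedge R E (map z (sorted_list_of_set (\<tau> ! j))) \<in> carrier (ext_power R E (card (D ! j)))"
      if j: "j < length D" for j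
    proof (rule E.wedge_closed)
      have \<tau>: "\<tau> ! j \<subseteq> {1..n}" "card (\<tau> ! j) = card (D ! j)"
        using \<open>\<tau> \<in> fillings n D\<close> j by (auto simp: fillings_def)
      \<comment> \<open>Finiteness is what makes \<open>sorted_list_of_set\<close> list the elements
        of \<open>\<tau> ! j\<close>.\<close>
      then have "finite (\<tau> ! j)" using finite_subset by blast
      with \<tau> z show "set (map z (sorted_list_of_set (\<tau> ! j))) \<subseteq> carrier E"
        "length (map z (sorted_list_of_set (\<tau> ! j))) = card (D ! j)"
        by auto
    qed
    then show "map (\<lambda>b. wedge R E (map z (sorted_list_of_set b))) \<tau> \<in> listset (map carrier ?W)"
      using that by (auto simp: mem_listset_iff fillings_def)
  qed assumption
  have "exchange_rels R E n z D \<subseteq> carrier (TE R E D)"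
    unfolding exchange_rels_def
  proof clarify
    fix c assume c: "c \<in> fillings n D \<rightarrow> carrier R"
    show "(\<Oplus>\<^bsub>TE R E D\<^esub>\<tau>\<in>fillings n D. c \<tau> \<odot>\<^bsub>TE R E D\<^esub> TE_basis R E z D \<tau>) \<in> carrier (TE R E D)"
      using c basis by (intro T.M.finsum_closed funcsetI T.smult_closed) blast+
  qed
  then show ?thesis using module_hom_closed[OF hom] by blast
qed

text \<open>With the same flag at both ends each layer is an identity: first the column maps, then
  their tensor product, then the map induced on the quotient by the exchange relations.\<close>

lemma schur_map_identity:
  assumes R: "cring R" and E: "module R E" and z: "z \<in> {1..n} \<rightarrow> carrier E"
    and Y: "Y \<in> carrier (schur_module R E n z F D)"
  shows "schur_map R E n z F D Y = Y"
proof -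
  interpret E: module R E by fact
  have cols: "\<And>M. M \<in> set (map (column_module R E F) D) \<Longrightarrow> module R M"
    using module.module_quot_module[OF E.module_ext_power E.column_rels_subset]
    by (auto simp: column_module_def)
  interpret TF: module R "TF R E F D" unfolding TF_def by (rule module_tensor[OF R cols])
  note sub = schur_exchange_subset[OF R E z, of F D]
  have col: "column_map R E F a Z = Z" if "Z \<in> carrier (column_module R E F a)" for a Z
    using module.induced_quot_proj_self[OF E.module_ext_power E.column_rels_subset] that
    unfolding column_map_def column_proj_def column_module_def .
  have "tensor_map R (map (column_module R E F) D) (map (column_map R E F) D) y = y" if "y \<in> Y" for y
  proof (rule tensor_map_identity[OF R cols])
    show "y \<in> carrier (tensor R (map (column_module R E F) D))"
      using TF.quot_module_subset_carrier[OF sub] Y that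
      unfolding schur_module_def TF_def by blast
  qed (simp_all add: col)
  then have "schur_map R E n z F D Y = induced (schur_proj R E n z F D) Y"
    unfolding schur_map_def by (intro induced_cong) simp
  also have "\<dots> = Y"
    using TF.induced_quot_proj_self[OF sub] Y unfolding schur_proj_def schur_module_def .
  finally show ?thesis .
qed

text \<open>A quotient and its projection depend on the relations only through the submodule they
  generate, so the columns, and with them the Schur modules, are equal as records and not merely
  isomorphic.\<close>

lemma schur_module_cong:
  assumes "\<And>a. a \<in> set D \<Longrightarrow>
    submod_gen R (ext_power R E (card a)) (column_rels R E F a)
      = submod_gen R (ext_power R E (card a)) (column_rels R E G a)"
  shows "schur_module R E n z F D = schur_module R E n z G D"
proof -
  have "map (column_module R E F) D = map (column_module R E G) D"
    "map (column_proj R E F) D = map (column_proj R E G) D"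
    using assms by (auto simp: column_module_def column_proj_def quot_module_def quot_proj_def fun_eq_iff)
  then show ?thesis by (simp only: schur_module_def TF_def TE_to_TF_def)
qed

theorem lemma4p4:
  fixes R :: "('a, 'r) ring_scheme"
    and E :: "('a, 'e, 'm) module_scheme"
    and z :: "nat \<Rightarrow> 'e"
    and n k :: nat
    and D :: diagram
  assumes "cring R" and "module R E" and "is_basis R E n z"
    and "1 \<le> k" and "k \<le> n" and "in_rows n D"
    and "k_full k D"
  shows "schur_map R E n z (BS_op k (standard_flag R E n z)) D
    \<in> module_iso R
        (schur_module R E n z (BS_op (k + 1) (standard_flag R E n z)) D)
        (schur_module R E n z (BS_op k (standard_flag R E n z)) D)"
proof -
  interpret E: module R E by fact
  let ?F = "BS_op k (standard_flag R E n z)"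
  let ?S = "schur_module R E n z ?F D"
  have z: "z \<in> {1..n} \<rightarrow> carrier E" using assms(3) by (simp add: is_basis_def)
  \<comment> \<open>The fullness of \<open>D\<close> enters here; from now on source and target are
    the same module.\<close>
  have eq: "schur_module R E n z (BS_op (k + 1) (standard_flag R E n z)) D = ?S"
    using assms(4,6,7) by (intro schur_module_cong E.submod_gen_column_rels[OF z])
      (auto simp: in_rows_def k_full_def)
  have cols: "\<And>M. M \<in> set (map (column_module R E ?F) D) \<Longrightarrow> module R M"
    using module.module_quot_module[OF E.module_ext_power E.column_rels_subset]
    by (auto simp: column_module_def)
  interpret S: module R ?S
    using module.module_quot_module[OF module_tensor[OF assms(1) cols]
        schur_exchange_subset[OF assms(1,2) z, of ?F D, unfolded TF_def]]
    by (simp add: schur_module_def TF_def)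
  note id = schur_map_identity[OF assms(1,2) z]
  have "schur_map R E n z ?F D \<in> module_hom R ?S ?S"
    by (rule module_homI) (simp_all add: id)
  moreover have "bij_betw (schur_map R E n z ?F D) (carrier ?S) (carrier ?S)"
    \<comment> \<open>\<open>schur_map\<close> is known to agree with the identity on the carrier
      only, so bijectivity is transferred through \<open>bij_betw_cong\<close>.\<close>
    using bij_betw_id by (rule bij_betw_cong[THEN iffD1, rotated]) (simp add: id)
  ultimately show ?thesis unfolding eq module_iso_def by blast
qed

end
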